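(* Let $\widetilde{x}=[(x_\varepsilon)_\varepsilon]\in\widetilde{\mathbb{R}^n}$, let $\rho\in\mathscr{S}(\mathbb{R}^n)$ with $\int_{\mathbb{R}^n}\rho(x)\,dx=1$ and, for $q\in\mathbb{N}$, $$v_{\widetilde{x},q}:=(\rho_{\varepsilon^q}(x_\varepsilon-\cdot))_\varepsilon+\mathcal{N}_{\mathscr{S}}(\mathbb{R}^n)\in\mathcal{G}_{\mathscr{S}}(\mathbb{R}^n).$$ The sequence $(v_{\widetilde{x},q})_q$ converges to $\delta_{\widetilde{x}}$ in $\mathcal{L}(\mathcal{G}_{\mathscr{S}}(\mathbb{R}^n),\widetilde{\mathbb{C}})$.
   Context: All nets are indexed by $\varepsilon\in(0,1]$ and $O$-estimates are for $\varepsilon\to 0$. For $\eta>0$, $\rho_\eta(y)=\eta^{-n}\rho(y/\eta)$; so $\rho_{\varepsilon^q}(y)=\varepsilon^{-qn}\rho(\varepsilon^{-q}y)$. $\widetilde{\mathbb{C}}$ is the ring of nets $(z_\varepsilon)_\varepsilon\in\mathbb{C}^{(0,1]}$ with $|z_\varepsilon|=O(\varepsilon^{-N})$ for some $N\in\mathbb{N}$, modulo the nets with $|z_\varepsilon|=O(\varepsilon^q)$ for all $q\in\mathbb{N}$. For $z=[(z_\varepsilon)_\varepsilon]$, $|z|_{\mathrm e}=\exp(-\sup\{b\in\mathbb{R}: |z_\varepsilon|=O(\varepsilon^b)\})$; $\widetilde{\mathbb{C}}$ carries the topology of the ultrametric $|z-z'|_{\mathrm e}$. $\widetilde{\mathbb{R}^n}$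 is the set of nets $(x_\varepsilon)_\varepsilon\in(\mathbb{R}^n)^{(0,1]}$ with $|x_\varepsilon|=O(\varepsilon^{-N})$ for some $N$, modulo $(x_\varepsilon)_\varepsilon\sim(y_\varepsilon)_\varepsilon$ iff $|x_\varepsilon-y_\varepsilon|=O(\varepsilon^q)$ for all $q\in\mathbb{N}$. With $p_j(f)=\sup_{x\in\mathbb{R}^n,|\alpha|\le j}(1+|x|)^j|\partial^\alpha f(x)|$, $\mathcal{G}_{\mathscr{S}}(\mathbb{R}^n)=\mathcal{E}_{\mathscr{S}}(\mathbb{R}^n)/\mathcal{N}_{\mathscr{S}}(\mathbb{R}^n)$, where $\mathcal{E}_{\mathscr{S}}(\mathbb{R}^n)$ is the set of nets in $\mathscr{S}(\mathbb{R}^n)^{(0,1]}$ such that for all $j\in\mathbb{N}$ there is $N\in\mathbb{N}$ with $p_j(u_\varepsilon)=O(\varepsilon^{-N})$, and $\mathcal{N}_{\mathscr{S}}(\mathbb{R}^n)$ is the set of nets with $p_j(u_\varepsilon)=O(\varepsilon^q)$ for all $j,q\in\mathbb{N}$. It carries the topology determined by $\mathcal{P}_j(u)=\exp(-\sup\{b\in\mathbb{R}:p_j(u_\varepsilon)=O(\varepsilon^b)\})$, $j\in\mathbb{N}$; a subset $B$ is bounded if every $\mathcal{P}_j$ is bounded on $B$. $\mathcal{L}(\mathcal{G}_{\mathscr{S}}(\mathbb{R}^n),\widetilde{\mathbb{C}})$ is the space of continuous $\widetilde{\mathbb{C}}$-linear functionals, with the topology of uniform convergence on bounded subsets, determined by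 $T\mapsto\sup_{u\in B}|Tu|_{\mathrm e}$, $B$ bounded. $\delta_{\widetilde{x}}\in\mathcal{L}(\mathcal{G}_{\mathscr{S}}(\mathbb{R}^n),\widetilde{\mathbb{C}})$ is the functional $u\mapsto u(\widetilde{x}):=[(u_\varepsilon(x_\varepsilon))_\varepsilon]$. An element $v\in\mathcal{G}_{\mathscr{S}}(\mathbb{R}^n)$ is regarded as the element $u\mapsto\int_{\mathbb{R}^n}v(y)u(y)\,dy:=[(\int_{\mathbb{R}^n}v_\varepsilon(y)u_\varepsilon(y)\,dy)_\varepsilon]$ of $\mathcal{L}(\mathcal{G}_{\mathscr{S}}(\mathbb{R}^n),\widetilde{\mathbb{C}})$. *)

theory Defs
  imports "HOL-Analysis.Analysis" "HOL-Library.Landau_Symbols"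
begin

section \<open>Asymptotics of nets\<close>

text \<open>
  A net indexed by \<open>(0,1]\<close> is represented by a function on the reals whose values outside
  \<open>(0,1]\<close> are irrelevant: all growth conditions are for \<open>\<epsilon> \<rightarrow> 0+\<close>, and in the quotients below
  two nets that agree on \<open>(0,1]\<close> are identified.
\<close>

definition bigO_pow :: "(real \<Rightarrow> real) \<Rightarrow> real \<Rightarrow> bool" where
  "bigO_pow r b \<longleftrightarrow> r \<in> O[at_right 0](\<lambda>\<epsilon>. \<epsilon> powr b)"

definition moderate :: "(real \<Rightarrow> real) \<Rightarrow> bool" where
  "moderate r \<longleftrightarrow> (\<exists>N::nat. bigO_pow r (- real N))"

definition negligible_net :: "(real \<Rightarrow> real) \<Rightarrow> bool" where
  "negligible_net r \<longleftrightarrow> (\<forall>q::nat. bigO_pow r (real q))"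

definition sharp_val :: "(real \<Rightarrow> real) \<Rightarrow> ereal" where
  "sharp_val r = Sup (ereal ` {b. bigO_pow r b})"

text \<open>For moderate nets the valuation is never \<open>-\<infinity>\<close>, so this is \<open>exp (- sharp_val r)\<close> with
  \<open>exp (-\<infinity>) = 0\<close>.\<close>

definition sharp_norm :: "(real \<Rightarrow> real) \<Rightarrow> real" where
  "sharp_norm r = (if sharp_val r = \<infinity> then 0 else exp (- real_of_ereal (sharp_val r)))"

lemma bigO_pow_iff:
  "bigO_pow r b \<longleftrightarrow> (\<exists>c>0. eventually (\<lambda>\<epsilon>. \<bar>r \<epsilon>\<bar> \<le> c * \<epsilon> powr b) (at_right 0))"
  by (simp add: bigO_pow_def bigo_def)

lemma bigO_pow_mono:
  assumes "bigO_pow r a" "b \<le> a" shows "bigO_pow r b"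
proof -
  have "eventually (\<lambda>\<epsilon>::real. \<epsilon> \<in> {0<..<1}) (at_right 0)"
    by (rule eventually_at_right_real) simp
  then have "eventually (\<lambda>\<epsilon>. norm (\<epsilon> powr a) \<le> 1 * norm (\<epsilon> powr b)) (at_right 0)"
    by eventually_elim (use assms(2) in \<open>auto intro: powr_mono'\<close>)
  then have "(\<lambda>\<epsilon>. \<epsilon> powr a) \<in> O[at_right 0](\<lambda>\<epsilon>. \<epsilon> powr b)"
    by (rule bigoI)
  with assms(1) show ?thesis
    unfolding bigO_pow_def by (rule landau_o.big_trans)
qed

lemma bigO_pow_le:
  assumes "bigO_pow s b" "\<And>\<epsilon>. \<epsilon> \<in> {0<..1} \<Longrightarrow> \<bar>r \<epsilon>\<bar> \<le> \<bar>s \<epsilon>\<bar>"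
  shows "bigO_pow r b"
proof -
  have "eventually (\<lambda>\<epsilon>::real. \<epsilon> \<in> {0<..<1}) (at_right 0)"
    by (rule eventually_at_right_real) simp
  then have "eventually (\<lambda>\<epsilon>. norm (r \<epsilon>) \<le> 1 * norm (s \<epsilon>)) (at_right 0)"
    by eventually_elim (use assms(2) in auto)
  then have "r \<in> O[at_right 0](s)" by (rule bigoI)
  with assms(1) show ?thesis unfolding bigO_pow_def by (blast intro: landau_o.big_trans)
qed

lemma bigO_pow_add:
  "bigO_pow r b \<Longrightarrow> bigO_pow s b \<Longrightarrow> bigO_pow (\<lambda>\<epsilon>. r \<epsilon> + s \<epsilon>) b"
  unfolding bigO_pow_def by (rule sum_in_bigo)

lemma bigO_pow_mult:
  assumes "bigO_pow r a" "bigO_pow s b"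
  shows "bigO_pow (\<lambda>\<epsilon>. r \<epsilon> * s \<epsilon>) (a + b)"
  using landau_o.big_mult[of r "at_right 0" "\<lambda>\<epsilon>. \<epsilon> powr a" s "\<lambda>\<epsilon>. \<epsilon> powr b"] assms
  by (simp add: bigO_pow_def powr_add)

lemma moderate_le:
  "moderate s \<Longrightarrow> (\<And>\<epsilon>. \<epsilon> \<in> {0<..1} \<Longrightarrow> \<bar>r \<epsilon>\<bar> \<le> \<bar>s \<epsilon>\<bar>) \<Longrightarrow> moderate r"
  unfolding moderate_def by (meson bigO_pow_le)

lemma negligible_net_le:
  "negligible_net s \<Longrightarrow> (\<And>\<epsilon>. \<epsilon> \<in> {0<..1} \<Longrightarrow> \<bar>r \<epsilon>\<bar> \<le> \<bar>s \<epsilon>\<bar>) \<Longrightarrow> negligible_net r"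
  unfolding negligible_net_def by (meson bigO_pow_le)

lemma moderate_add:
  assumes "moderate r" "moderate s" shows "moderate (\<lambda>\<epsilon>. r \<epsilon> + s \<epsilon>)"
proof -
  obtain M N :: nat where "bigO_pow r (- real M)" "bigO_pow s (- real N)"
    using assms by (auto simp: moderate_def)
  then have "bigO_pow r (- real (max M N))" "bigO_pow s (- real (max M N))"
    by (auto elim!: bigO_pow_mono)
  then show ?thesis unfolding moderate_def by (blast intro: bigO_pow_add)
qed

lemma moderate_mult:
  assumes "moderate r" "moderate s" shows "moderate (\<lambda>\<epsilon>. r \<epsilon> * s \<epsilon>)"
proof -
  obtain M N :: nat where "bigO_pow r (- real M)" "bigO_pow s (- real N)"
    using assms by (auto simp: moderate_def)
  from bigO_pow_mult[OF this] have "bigO_pow (\<lambda>\<epsilon>. r \<epsilon> * s \<epsilon>) (- real (M + N))"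
    by simp
  then show ?thesis unfolding moderate_def by blast
qed

lemma negligible_net_add:
  "negligible_net r \<Longrightarrow> negligible_net s \<Longrightarrow> negligible_net (\<lambda>\<epsilon>. r \<epsilon> + s \<epsilon>)"
  by (simp add: negligible_net_def bigO_pow_add)

lemma negligible_net_mult:
  assumes "negligible_net r" "moderate s" shows "negligible_net (\<lambda>\<epsilon>. r \<epsilon> * s \<epsilon>)"
  unfolding negligible_net_def
proof
  fix q :: nat
  obtain N :: nat where N: "bigO_pow s (- real N)" using assms by (auto simp: moderate_def)
  have "bigO_pow r (real (q + N))" using assms(1) unfolding negligible_net_def by blast
  from bigO_pow_mult[OF this N] show "bigO_pow (\<lambda>\<epsilon>. r \<epsilon> * s \<epsilon>) (real q)" by simp
qed

lemma negligible_net_mult':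
  "moderate r \<Longrightarrow> negligible_net s \<Longrightarrow> negligible_net (\<lambda>\<epsilon>. r \<epsilon> * s \<epsilon>)"
  using negligible_net_mult[of s r] by (simp add: mult.commute)

lemma moderate_const: "moderate (\<lambda>_. c)"
  unfolding moderate_def bigO_pow_def by (rule exI[of _ 0]) (rule bigoI[of _ "\<bar>c\<bar>"], 
    simp add: eventually_at_right_field, rule exI[of _ 1], simp)

lemma negligible_net_0: "negligible_net (\<lambda>_. 0)"
  unfolding negligible_net_def bigO_pow_def by simp

lemma negligible_imp_moderate: "negligible_net r \<Longrightarrow> moderate r"
  unfolding negligible_net_def moderate_def by (rule exI[of _ 0]) (metis minus_zero of_nat_0)

lemma negligible_bigO_pow: "negligible_net r \<Longrightarrow> bigO_pow r b"
  unfolding negligible_net_def by (meson bigO_pow_mono real_nat_ceiling_ge)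

lemma not_negligible_1: "\<not> negligible_net (\<lambda>_. 1)"
proof
  assume "negligible_net (\<lambda>_. 1)"
  then obtain c :: real where "c > 0" and ev: "eventually (\<lambda>\<epsilon>. \<bar>1\<bar> \<le> c * \<epsilon> powr 1) (at_right 0)"
    using negligible_bigO_pow[of "\<lambda>_. 1" 1, unfolded bigO_pow_iff] by blast
  have "eventually (\<lambda>\<epsilon>::real. \<epsilon> \<in> {0<..<1 / c}) (at_right 0)"
    by (rule eventually_at_right_real) (use \<open>c > 0\<close> in simp)
  with ev have "eventually (\<lambda>\<epsilon>::real. False) (at_right 0)"
    by eventually_elim (use \<open>c > 0\<close> in \<open>simp add: pos_less_divide_eq mult.commute\<close>)
  then show False by simp
qed

lemma sharp_val_eqI: "(\<And>b. bigO_pow r b \<longleftrightarrow> bigO_pow s b) \<Longrightarrow> sharp_val r = sharp_val s"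
  by (simp add: sharp_val_def)

lemma sharp_val_gt:
  assumes "ereal b < sharp_val r" shows "bigO_pow r b"
proof -
  obtain b' where "bigO_pow r b'" "b < b'"
    using assms by (auto simp: sharp_val_def less_Sup_iff)
  then show ?thesis by (auto elim: bigO_pow_mono)
qed

lemma sharp_val_moderate: "moderate r \<Longrightarrow> sharp_val r \<noteq> -\<infinity>"
  unfolding moderate_def sharp_val_def
  by (metis (mono_tags, lifting) MInfty_neq_ereal(1) Sup_eq_MInfty imageI mem_Collect_eq
      empty_iff singletonD)

lemma sharp_val_PInf_iff: "sharp_val r = \<infinity> \<longleftrightarrow> negligible_net r"
proof
  assume "sharp_val r = \<infinity>"
  then show "negligible_net r" unfolding negligible_net_def by (auto intro: sharp_val_gt)
next
  assume "negligible_net r"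
  then have "{b. bigO_pow r b} = UNIV" by (auto intro: negligible_bigO_pow)
  then show "sharp_val r = \<infinity>" unfolding sharp_val_def
    by (metis SUP_PInfty UNIV_I less_eq_ereal_def ereal_less_eq(3) real_arch_simple order_refl)
qed

lemma sharp_norm_nonneg: "sharp_norm r \<ge> 0"
  by (simp add: sharp_norm_def)

lemma sharp_norm_0_iff: "sharp_norm r = 0 \<longleftrightarrow> negligible_net r"
  by (simp add: sharp_norm_def sharp_val_PInf_iff)

lemma sharp_norm_antimono:
  assumes "sharp_val r \<le> sharp_val s" "moderate r"
  shows "sharp_norm s \<le> sharp_norm r"
  using assms sharp_val_moderate[of r]
  by (cases "sharp_val r"; cases "sharp_val s") (auto simp: sharp_norm_def)

lemma sharp_norm_ultra:
  assumes le: "\<And>\<epsilon>. \<epsilon> \<in> {0<..1} \<Longrightarrow> \<bar>t \<epsilon>\<bar> \<le> \<bar>r \<epsilon>\<bar> + \<bar>s \<epsilon>\<bar>" and mod: "moderate r" "moderate s"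
  shows "sharp_norm t \<le> max (sharp_norm r) (sharp_norm s)"
proof -
  have "min (sharp_val r) (sharp_val s) \<le> sharp_val t"
  proof (rule ereal_le_real, rule ccontr)
    fix z assume z: "sharp_val t \<le> ereal z" "\<not> min (sharp_val r) (sharp_val s) \<le> ereal z"
    then obtain z' where z': "ereal z < ereal z'" "ereal z' < min (sharp_val r) (sharp_val s)"
      by (meson ereal_dense2 not_le)
    then have "bigO_pow r z'" "bigO_pow s z'" by (auto intro: sharp_val_gt)
    then have "bigO_pow (\<lambda>\<epsilon>. \<bar>r \<epsilon>\<bar>) z'" "bigO_pow (\<lambda>\<epsilon>. \<bar>s \<epsilon>\<bar>) z'"
      by (auto elim: bigO_pow_le)
    then have "bigO_pow (\<lambda>\<epsilon>. \<bar>r \<epsilon>\<bar> + \<bar>s \<epsilon>\<bar>) z'" by (rule bigO_pow_add)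
    then have "bigO_pow t z'" by (rule bigO_pow_le) (use le in force)
    then have "ereal z' \<le> sharp_val t" by (auto simp: sharp_val_def intro: Sup_upper)
    with z(1) z'(1) show False using order_trans by fastforce
  qed
  then show ?thesis
    using sharp_norm_antimono[of r t] sharp_norm_antimono[of s t] mod
    by (auto simp: min_def max_def split: if_splits)
qed

section \<open>Generalized points and numbers\<close>

text \<open>\<open>complex gen\<close> is the ring of generalized complex numbers, \<open>(real^'n) gen\<close> the set of
  generalized points.\<close>

definition moderate_nets :: "(real \<Rightarrow> 'a::real_normed_vector) set" where
  "moderate_nets = {x. moderate (\<lambda>\<epsilon>. norm (x \<epsilon>))}"

definition gen_rel :: "(real \<Rightarrow> 'a::real_normed_vector) \<Rightarrow> (real \<Rightarrow> 'a) \<Rightarrow> bool" where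
  "gen_rel x y \<longleftrightarrow> x \<in> moderate_nets \<and> y \<in> moderate_nets \<and> negligible_net (\<lambda>\<epsilon>. norm (x \<epsilon> - y \<epsilon>))"

lemma gen_rel_refl: "gen_rel x x \<longleftrightarrow> x \<in> moderate_nets"
  by (simp add: gen_rel_def negligible_net_0)

lemma gen_rel_part_equivp: "part_equivp gen_rel"
proof (rule part_equivpI)
  show "\<exists>x::real \<Rightarrow> 'a. gen_rel x x"
    by (rule exI[of _ "\<lambda>_. 0"]) (simp add: gen_rel_refl moderate_nets_def moderate_const)
  show "symp (gen_rel :: (real \<Rightarrow> 'a) \<Rightarrow> _)"
    by (rule sympI) (simp add: gen_rel_def norm_minus_commute)
  show "transp (gen_rel :: (real \<Rightarrow> 'a) \<Rightarrow> _)"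
  proof (rule transpI)
    fix x y z :: "real \<Rightarrow> 'a" assume a: "gen_rel x y" "gen_rel y z"
    then have "negligible_net (\<lambda>\<epsilon>. norm (x \<epsilon> - y \<epsilon>) + norm (y \<epsilon> - z \<epsilon>))"
      by (simp add: gen_rel_def negligible_net_add)
    then have "negligible_net (\<lambda>\<epsilon>. norm (x \<epsilon> - z \<epsilon>))"
      by (rule negligible_net_le) (simp, metis diff_add_cancel add_diff_eq norm_triangle_ineq)
    with a show "gen_rel x z" by (simp add: gen_rel_def)
  qed
qed

quotient_type (overloaded) 'a gen = "real \<Rightarrow> 'a::real_normed_vector" / partial: gen_rel
  morphisms rep_gen gen_of
  by (rule gen_rel_part_equivp)

lemma moderate_nets_add:
  "x \<in> moderate_nets \<Longrightarrow> y \<in> moderate_nets \<Longrightarrow> (\<lambda>\<epsilon>. x \<epsilon> + y \<epsilon>) \<in> moderate_nets"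
  unfolding moderate_nets_def
  by (auto intro: moderate_le[OF moderate_add] simp: norm_triangle_ineq)

lemma moderate_nets_diff:
  "x \<in> moderate_nets \<Longrightarrow> y \<in> moderate_nets \<Longrightarrow> (\<lambda>\<epsilon>. x \<epsilon> - y \<epsilon>) \<in> moderate_nets"
  unfolding moderate_nets_def
  by (auto intro: moderate_le[OF moderate_add] simp: norm_triangle_ineq4)

lemma moderate_nets_mult:
  fixes x y :: "real \<Rightarrow> 'a::real_normed_field"
  shows "x \<in> moderate_nets \<Longrightarrow> y \<in> moderate_nets \<Longrightarrow> (\<lambda>\<epsilon>. x \<epsilon> * y \<epsilon>) \<in> moderate_nets"
  unfolding moderate_nets_def by (auto simp: norm_mult moderate_mult)

lemma moderate_nets_const: "(\<lambda>_. c) \<in> moderate_nets"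
  by (simp add: moderate_nets_def moderate_const)

instantiation gen :: (real_normed_vector) ab_group_add
begin

lift_definition zero_gen :: "'a gen" is "\<lambda>_. 0"
  by (simp add: gen_rel_refl moderate_nets_const)

lift_definition plus_gen :: "'a gen \<Rightarrow> 'a gen \<Rightarrow> 'a gen" is "\<lambda>x y \<epsilon>. x \<epsilon> + y \<epsilon>"
proof -
  fix x x' y y' :: "real \<Rightarrow> 'a" assume a: "gen_rel x x'" "gen_rel y y'"
  then have "negligible_net (\<lambda>\<epsilon>. norm (x \<epsilon> - x' \<epsilon>) + norm (y \<epsilon> - y' \<epsilon>))"
    by (simp add: gen_rel_def negligible_net_add)
  then have "negligible_net (\<lambda>\<epsilon>. norm ((x \<epsilon> + y \<epsilon>) - (x' \<epsilon> + y' \<epsilon>)))"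
    by (rule negligible_net_le) (use norm_diff_triangle_ineq in auto)
  with a show "gen_rel (\<lambda>\<epsilon>. x \<epsilon> + y \<epsilon>) (\<lambda>\<epsilon>. x' \<epsilon> + y' \<epsilon>)"
    by (simp add: gen_rel_def moderate_nets_add)
qed

lift_definition uminus_gen :: "'a gen \<Rightarrow> 'a gen" is "\<lambda>x \<epsilon>. - x \<epsilon>"
proof -
  fix x y :: "real \<Rightarrow> 'a" assume "gen_rel x y"
  then show "gen_rel (\<lambda>\<epsilon>. - x \<epsilon>) (\<lambda>\<epsilon>. - y \<epsilon>)"
    by (simp add: gen_rel_def moderate_nets_def norm_minus_commute)
qed

definition minus_gen :: "'a gen \<Rightarrow> 'a gen \<Rightarrow> 'a gen" where
  "minus_gen x y = x + - y"

instance
proof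
  fix a b c :: "'a gen"
  show "a + b + c = a + (b + c)"
    by transfer (auto simp: add.assoc gen_rel_refl intro: moderate_nets_add)
  show "a + b = b + a"
    by transfer (auto simp: add.commute gen_rel_refl intro: moderate_nets_add)
  show "0 + a = a" by transfer (simp add: gen_rel_refl)
  show "- a + a = 0" by transfer (simp add: gen_rel_refl moderate_nets_const)
  show "a - b = a + - b" by (rule minus_gen_def)
qed

end

instantiation gen :: (real_normed_field) comm_ring_1
begin

lift_definition one_gen :: "'a gen" is "\<lambda>_. 1"
  by (simp add: gen_rel_refl moderate_nets_const)

lift_definition times_gen :: "'a gen \<Rightarrow> 'a gen \<Rightarrow> 'a gen" is "\<lambda>x y \<epsilon>. x \<epsilon> * y \<epsilon>"
proof -
  fix x x' y y' :: "real \<Rightarrow> 'a" assume a: "gen_rel x x'" "gen_rel y y'"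
  have "negligible_net (\<lambda>\<epsilon>. norm (x \<epsilon> - x' \<epsilon>) * norm (y \<epsilon>) + norm (x' \<epsilon>) * norm (y \<epsilon> - y' \<epsilon>))"
  proof (rule negligible_net_add)
    show "negligible_net (\<lambda>\<epsilon>. norm (x \<epsilon> - x' \<epsilon>) * norm (y \<epsilon>))"
      by (rule negligible_net_mult) (use a in \<open>simp_all add: gen_rel_def moderate_nets_def\<close>)
    show "negligible_net (\<lambda>\<epsilon>. norm (x' \<epsilon>) * norm (y \<epsilon> - y' \<epsilon>))"
      by (rule negligible_net_mult') (use a in \<open>simp_all add: gen_rel_def moderate_nets_def\<close>)
  qed
  then have "negligible_net (\<lambda>\<epsilon>. norm (x \<epsilon> * y \<epsilon> - x' \<epsilon> * y' \<epsilon>))"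
  proof (rule negligible_net_le)
    fix \<epsilon> :: real
    have "x \<epsilon> * y \<epsilon> - x' \<epsilon> * y' \<epsilon> = (x \<epsilon> - x' \<epsilon>) * y \<epsilon> + x' \<epsilon> * (y \<epsilon> - y' \<epsilon>)"
      by (simp add: algebra_simps)
    then show "\<bar>norm (x \<epsilon> * y \<epsilon> - x' \<epsilon> * y' \<epsilon>)\<bar>
        \<le> \<bar>norm (x \<epsilon> - x' \<epsilon>) * norm (y \<epsilon>) + norm (x' \<epsilon>) * norm (y \<epsilon> - y' \<epsilon>)\<bar>"
      using norm_triangle_ineq[of "(x \<epsilon> - x' \<epsilon>) * y \<epsilon>" "x' \<epsilon> * (y \<epsilon> - y' \<epsilon>)"]
      by (simp add: norm_mult)
  qed
  with a show "gen_rel (\<lambda>\<epsilon>. x \<epsilon> * y \<epsilon>) (\<lambda>\<epsilon>. x' \<epsilon> * y' \<epsilon>)"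
    by (simp add: gen_rel_def moderate_nets_mult)
qed

instance
proof
  fix a b c :: "'a gen"
  show "a * b * c = a * (b * c)"
    by transfer (simp add: mult.assoc gen_rel_refl moderate_nets_mult)
  show "a * b = b * a"
    by transfer (simp add: mult.commute gen_rel_refl moderate_nets_mult)
  show "1 * a = a" by transfer (simp add: gen_rel_refl)
  show "(a + b) * c = a * c + b * c"
    by transfer (simp add: distrib_right gen_rel_refl moderate_nets_mult moderate_nets_add)
  show "(0::'a gen) \<noteq> 1"
    by transfer (simp add: gen_rel_def not_negligible_1)
qed

end

lift_definition e_norm :: "'a::real_normed_vector gen \<Rightarrow> real" is
  "\<lambda>x. sharp_norm (\<lambda>\<epsilon>. norm (x \<epsilon>))"
proof -
  have le: "bigO_pow (\<lambda>\<epsilon>. norm (y \<epsilon>)) b"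
    if "gen_rel x y" "bigO_pow (\<lambda>\<epsilon>. norm (x \<epsilon>)) b" for x y :: "real \<Rightarrow> 'a" and b
  proof -
    have "bigO_pow (\<lambda>\<epsilon>. norm (x \<epsilon>) + norm (x \<epsilon> - y \<epsilon>)) b"
      using that by (intro bigO_pow_add) (auto simp: gen_rel_def negligible_bigO_pow)
    then show ?thesis
    proof (rule bigO_pow_le)
      fix \<epsilon> :: real
      show "\<bar>norm (y \<epsilon>)\<bar> \<le> \<bar>norm (x \<epsilon>) + norm (x \<epsilon> - y \<epsilon>)\<bar>"
        using norm_triangle_sub[of "y \<epsilon>" "x \<epsilon>"] by (simp add: norm_minus_commute)
    qed
  qed
  fix x y :: "real \<Rightarrow> 'a" assume a: "gen_rel x y"
  then have "gen_rel y x" by (simp add: gen_rel_def norm_minus_commute)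
  with a le have "sharp_val (\<lambda>\<epsilon>. norm (x \<epsilon>)) = sharp_val (\<lambda>\<epsilon>. norm (y \<epsilon>))"
    by (intro sharp_val_eqI) blast
  then show "sharp_norm (\<lambda>\<epsilon>. norm (x \<epsilon>)) = sharp_norm (\<lambda>\<epsilon>. norm (y \<epsilon>))"
    by (simp add: sharp_norm_def)
qed

lemma e_norm_0_iff: "e_norm x = 0 \<longleftrightarrow> x = 0"
  by transfer (simp add: sharp_norm_0_iff gen_rel_def moderate_nets_const)

lemma e_norm_minus: "e_norm (- x) = e_norm x"
  by transfer simp

lemma e_norm_nonneg: "e_norm x \<ge> 0"
  by transfer (rule sharp_norm_nonneg)

lemma e_norm_add: "e_norm (x + y) \<le> max (e_norm x) (e_norm y)"
  by transfer (rule sharp_norm_ultra; simp add: gen_rel_def moderate_nets_def norm_triangle_ineq)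

instantiation gen :: (real_normed_vector) metric_space
begin

definition dist_gen :: "'a gen \<Rightarrow> 'a gen \<Rightarrow> real" where
  "dist_gen x y = e_norm (x - y)"

definition uniformity_gen :: "('a gen \<times> 'a gen) filter" where
  "uniformity_gen = (INF e\<in>{0<..}. principal {(x, y). dist x y < e})"

definition open_gen :: "'a gen set \<Rightarrow> bool" where
  "open_gen U \<longleftrightarrow> (\<forall>x\<in>U. \<forall>\<^sub>F (x', y) in uniformity. x' = x \<longrightarrow> y \<in> U)"

instance
proof
  fix x y z :: "'a gen"
  show "dist x y = 0 \<longleftrightarrow> x = y" by (simp add: dist_gen_def e_norm_0_iff)
  have "e_norm (x - y) \<le> max (e_norm (x - z)) (e_norm (- (y - z)))"
    using e_norm_add[of "x - z" "- (y - z)"] by simp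
  then show "dist x y \<le> dist x z + dist y z"
    using e_norm_nonneg[of "x - z"] e_norm_nonneg[of "y - z"]
    unfolding dist_gen_def e_norm_minus by linarith
qed (rule uniformity_gen_def open_gen_def)+

end


section \<open>Schwartz functions\<close>

definition partial_deriv :: "'n::finite \<Rightarrow> (real^'n \<Rightarrow> complex) \<Rightarrow> real^'n \<Rightarrow> complex" where
  "partial_deriv i f x = vector_derivative (\<lambda>t. f (x + t *\<^sub>R axis i 1)) (at 0)"

definition partial_derivs :: "'n::finite list \<Rightarrow> (real^'n \<Rightarrow> complex) \<Rightarrow> real^'n \<Rightarrow> complex" where
  "partial_derivs is f = foldr partial_deriv is f"

text \<open>\<open>C\<^sup>\<infinity>\<close>: all iterated partial derivatives exist and are (totally) differentiable.\<close>

definition smooth :: "(real^'n \<Rightarrow> complex) \<Rightarrow> bool" where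
  "smooth f \<longleftrightarrow> (\<forall>is x. partial_derivs is f differentiable (at x))"

text \<open>The finite index type \<open>'n\<close> has no canonical order; the partial derivatives in
  \<open>\<partial>\<^sup>\<alpha>\<close> are taken in some fixed order, which is immaterial for smooth functions.\<close>

definition coords :: "'n::finite list" where
  "coords = (SOME is. distinct is \<and> set is = UNIV)"

definition multi_deriv :: "('n::finite \<Rightarrow> nat) \<Rightarrow> (real^'n \<Rightarrow> complex) \<Rightarrow> real^'n \<Rightarrow> complex" where
  "multi_deriv \<alpha> f = partial_derivs (concat (map (\<lambda>i. replicate (\<alpha> i) i) coords)) f"

definition weighted_derivs :: "nat \<Rightarrow> (real^'n::finite \<Rightarrow> complex) \<Rightarrow> real set" where
  "weighted_derivs j f =
     {(1 + norm x) ^ j * norm (multi_deriv \<alpha> f x) | x \<alpha>. (\<Sum>i\<in>UNIV. \<alpha> i) \<le> j}"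

definition schwartz :: "(real^'n \<Rightarrow> complex) \<Rightarrow> bool" where
  "schwartz f \<longleftrightarrow> smooth f \<and> (\<forall>j. bdd_above (weighted_derivs j f))"

definition schwartz_norm :: "nat \<Rightarrow> (real^'n \<Rightarrow> complex) \<Rightarrow> real" where
  "schwartz_norm j f = Sup (weighted_derivs j f)"

lemma distinct_coords: "distinct (coords :: 'n::finite list)"
  and set_coords: "set (coords :: 'n::finite list) = UNIV"
proof -
  have "\<exists>is :: 'n list. distinct is \<and> set is = UNIV"
    using finite_distinct_list[OF finite_class.finite_UNIV] by blast
  from someI_ex[OF this] show "distinct (coords :: 'n list)" "set (coords :: 'n list) = UNIV"
    by (simp_all add: coords_def)
qed

lemma has_derivative_partial:
  assumes "(f has_derivative f') (at x)"
  shows "((\<lambda>t. f (x + t *\<^sub>R axis i 1)) has_vector_derivative f' (axis i 1)) (at 0)"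
proof -
  have "((\<lambda>t::real. x + t *\<^sub>R axis i 1) has_derivative (\<lambda>t. t *\<^sub>R axis i 1)) (at 0)"
    by (auto intro!: derivative_eq_intros)
  then have "((\<lambda>t. f (x + t *\<^sub>R axis i 1)) has_derivative (\<lambda>t. f' (t *\<^sub>R axis i 1))) (at 0)"
    using has_derivative_compose[of "\<lambda>t. x + t *\<^sub>R axis i 1" _ 0 UNIV f f'] assms by simp
  then show ?thesis
    using assms by (simp add: has_vector_derivative_def has_derivative_linear linear_cmul)
qed

lemma partial_deriv_eq: "(f has_derivative f') (at x) \<Longrightarrow> partial_deriv i f x = f' (axis i 1)"
  unfolding partial_deriv_def by (rule vector_derivative_at) (rule has_derivative_partial)

lemma partial_derivs_Nil: "partial_derivs [] f = f"
  and partial_derivs_Cons: "partial_derivs (i # is) f = partial_deriv i (partial_derivs is f)"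
  by (simp_all add: partial_derivs_def)

lemma smoothD: "smooth f \<Longrightarrow> partial_derivs is f differentiable (at x)"
  by (simp add: smooth_def)

lemma partial_derivs_add:
  assumes "smooth f" "smooth g"
  shows "partial_derivs is (\<lambda>x. f x + g x) = (\<lambda>x. partial_derivs is f x + partial_derivs is g x)"
proof (induction "is")
  case (Cons i "is")
  show ?case
  proof
    fix x
    obtain f' g' where d: "(partial_derivs is f has_derivative f') (at x)"
      "(partial_derivs is g has_derivative g') (at x)"
      using assms smoothD unfolding differentiable_def by meson
    from has_derivative_add[OF this] show "partial_derivs (i # is) (\<lambda>x. f x + g x) x =
        partial_derivs (i # is) f x + partial_derivs (i # is) g x"
      by (simp add: partial_derivs_Cons Cons partial_deriv_eq[OF d(1)] partial_deriv_eq[OF d(2)]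
          partial_deriv_eq)
  qed
qed (simp add: partial_derivs_Nil)

lemma partial_derivs_cmult:
  assumes "smooth f"
  shows "partial_derivs is (\<lambda>x. c * f x) = (\<lambda>x. c * partial_derivs is f x)"
proof (induction "is")
  case (Cons i "is")
  show ?case
  proof
    fix x
    obtain f' where d: "(partial_derivs is f has_derivative f') (at x)"
      using assms smoothD unfolding differentiable_def by meson
    from has_derivative_mult_right[OF this, of c]
    show "partial_derivs (i # is) (\<lambda>x. c * f x) x = c * partial_derivs (i # is) f x"
      by (simp add: partial_derivs_Cons Cons partial_deriv_eq[OF d] partial_deriv_eq)
  qed
qed (simp add: partial_derivs_Nil)

lemma smooth_add: "smooth f \<Longrightarrow> smooth g \<Longrightarrow> smooth (\<lambda>x. f x + g x)"
  by (simp add: smooth_def[of "\<lambda>x. f x + g x"] partial_derivs_add smoothD)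

lemma smooth_cmult: "smooth f \<Longrightarrow> smooth (\<lambda>x. c * f x)"
  by (simp add: smooth_def[of "\<lambda>x. c * f x"] partial_derivs_cmult smoothD)

lemma multi_deriv_add:
  "smooth f \<Longrightarrow> smooth g \<Longrightarrow> multi_deriv \<alpha> (\<lambda>x. f x + g x) x = multi_deriv \<alpha> f x + multi_deriv \<alpha> g x"
  by (simp add: multi_deriv_def partial_derivs_add)

lemma multi_deriv_cmult: "smooth f \<Longrightarrow> multi_deriv \<alpha> (\<lambda>x. c * f x) x = c * multi_deriv \<alpha> f x"
  by (simp add: multi_deriv_def partial_derivs_cmult)

lemma multi_deriv_0: "multi_deriv (\<lambda>_. 0) f = f"
proof -
  have "concat (map (\<lambda>i. replicate 0 i) is) = []" for "is" :: "'a list"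
    by (induction "is") auto
  from this[of coords] show ?thesis
    by (simp only: multi_deriv_def partial_derivs_Nil)
qed

lemma multi_deriv_1: "multi_deriv (\<lambda>j. if j = i then 1 else 0) f = partial_deriv i f"
proof -
  have "concat (map (\<lambda>j. replicate (if j = i then 1 else 0) j) is) = (if i \<in> set is then [i] else [])"
    if "distinct is" for "is" :: "'a list"
    using that by (induction "is") auto
  from this[OF distinct_coords] show ?thesis
    by (simp add: multi_deriv_def partial_derivs_Nil partial_derivs_Cons set_coords)
qed

lemma weighted_derivs_nonempty: "weighted_derivs j f \<noteq> {}"
  by (auto simp: weighted_derivs_def intro!: exI[of _ "\<lambda>_. 0"])

lemma schwartz_norm_upper:
  "schwartz f \<Longrightarrow> (\<Sum>i\<in>UNIV. \<alpha> i) \<le> j \<Longrightarrow> (1 + norm x) ^ j * norm (multi_deriv \<alpha> f x) \<le> schwartz_norm j f"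
  unfolding schwartz_norm_def by (rule cSup_upper) (auto simp: schwartz_def weighted_derivs_def)

lemma schwartz_norm_least:
  assumes "\<And>x \<alpha>. (\<Sum>i\<in>UNIV. \<alpha> i) \<le> j \<Longrightarrow> (1 + norm x) ^ j * norm (multi_deriv \<alpha> f x) \<le> C"
  shows "schwartz_norm j f \<le> C" "bdd_above (weighted_derivs j f)"
proof -
  show "schwartz_norm j f \<le> C"
    unfolding schwartz_norm_def
  proof (rule cSup_least)
    show "weighted_derivs j f \<noteq> {}" by (rule weighted_derivs_nonempty)
    show "z \<le> C" if "z \<in> weighted_derivs j f" for z
      using that assms by (auto simp: weighted_derivs_def)
  qed
  show "bdd_above (weighted_derivs j f)"
    by (rule bdd_aboveI[of _ C]) (use assms in \<open>auto simp: weighted_derivs_def\<close>)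
qed

lemma schwartz_norm_nonneg: "schwartz f \<Longrightarrow> 0 \<le> schwartz_norm j f"
  using schwartz_norm_upper[of f "\<lambda>_. 0" j 0] by (simp add: multi_deriv_0) (smt (verit) norm_ge_zero)

lemma schwartz_norm_weight: "schwartz f \<Longrightarrow> (1 + norm x) ^ j * norm (f x) \<le> schwartz_norm j f"
  using schwartz_norm_upper[of f "\<lambda>_. 0" j x] by (simp add: multi_deriv_0)

lemma schwartz_norm_0_upper: "schwartz f \<Longrightarrow> norm (f x) \<le> schwartz_norm 0 f"
  using schwartz_norm_weight[of f x 0] by simp

lemma
  assumes "schwartz f" "schwartz g"
  shows schwartz_add: "schwartz (\<lambda>x. f x + g x)"
    and schwartz_norm_add: "schwartz_norm j (\<lambda>x. f x + g x) \<le> schwartz_norm j f + schwartz_norm j g"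
proof -
  have *: "(1 + norm x) ^ j * norm (multi_deriv \<alpha> (\<lambda>x. f x + g x) x) \<le> schwartz_norm j f + schwartz_norm j g"
    if "(\<Sum>i\<in>UNIV. \<alpha> i) \<le> j" for x \<alpha> j
  proof -
    have "(1 + norm x) ^ j * norm (multi_deriv \<alpha> (\<lambda>x. f x + g x) x)
        \<le> (1 + norm x) ^ j * (norm (multi_deriv \<alpha> f x) + norm (multi_deriv \<alpha> g x))"
      using assms by (intro mult_left_mono) (auto simp: multi_deriv_add schwartz_def norm_triangle_ineq)
    also have "\<dots> \<le> schwartz_norm j f + schwartz_norm j g"
      using schwartz_norm_upper[OF assms(1) that, of x] schwartz_norm_upper[OF assms(2) that, of x]
      by (simp add: distrib_left)
    finally show ?thesis .
  qed
  show "schwartz_norm j (\<lambda>x. f x + g x) \<le> schwartz_norm j f + schwartz_norm j g"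
    by (rule schwartz_norm_least(1)) (rule *)
  show "schwartz (\<lambda>x. f x + g x)"
    using assms schwartz_norm_least(2)[OF *] by (auto simp: schwartz_def smooth_add)
qed

lemma
  assumes "schwartz f"
  shows schwartz_cmult: "schwartz (\<lambda>x. c * f x)"
    and schwartz_norm_cmult: "schwartz_norm j (\<lambda>x. c * f x) \<le> norm c * schwartz_norm j f"
proof -
  have *: "(1 + norm x) ^ j * norm (multi_deriv \<alpha> (\<lambda>x. c * f x) x) \<le> norm c * schwartz_norm j f"
    if "(\<Sum>i\<in>UNIV. \<alpha> i) \<le> j" for x \<alpha> j
    using assms mult_left_mono[OF schwartz_norm_upper[OF assms that, of x] norm_ge_zero[of c]]
    by (simp add: multi_deriv_cmult schwartz_def norm_mult mult_ac)
  show "schwartz_norm j (\<lambda>x. c * f x) \<le> norm c * schwartz_norm j f"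
    by (rule schwartz_norm_least(1)) (rule *)
  show "schwartz (\<lambda>x. c * f x)"
    using assms schwartz_norm_least(2)[OF *] by (auto simp: schwartz_def smooth_cmult)
qed

lemma partial_deriv_0: "partial_deriv i (\<lambda>_. 0) = (\<lambda>_. 0)"
  by (rule ext, rule trans[OF partial_deriv_eq[OF has_derivative_const]]) simp

lemma schwartz_zero: "schwartz (\<lambda>_. 0)"
proof -
  have "partial_derivs is (\<lambda>_. 0) = (\<lambda>_. 0)" for "is" :: "'a list"
    by (induction "is") (simp_all add: partial_derivs_Nil partial_derivs_Cons partial_deriv_0)
  then show ?thesis
    by (auto simp: schwartz_def smooth_def multi_deriv_def intro!: schwartz_norm_least(2)[of _ _ 0])
qed

lemma schwartz_norm_zero: "schwartz_norm j (\<lambda>_::real^'n::finite. 0) = 0"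
  using schwartz_norm_cmult[OF schwartz_zero[where 'a='n], of j 0]
    schwartz_norm_nonneg[OF schwartz_zero[where 'a='n], of j] by simp

lemma schwartz_uminus: "schwartz f \<Longrightarrow> schwartz (\<lambda>x. - f x)"
  using schwartz_cmult[of f "-1"] by simp

lemma schwartz_norm_uminus: "schwartz f \<Longrightarrow> schwartz_norm j (\<lambda>x. - f x) = schwartz_norm j f"
  using schwartz_norm_cmult[of f j "-1"] schwartz_norm_cmult[OF schwartz_uminus, of f j "-1"] by simp

lemma schwartz_diff: "schwartz f \<Longrightarrow> schwartz g \<Longrightarrow> schwartz (\<lambda>x. f x - g x)"
  using schwartz_add[OF _ schwartz_uminus, of f g] by simp

lemma schwartz_norm_diff:
  "schwartz f \<Longrightarrow> schwartz g \<Longrightarrow> schwartz_norm j (\<lambda>x. f x - g x) \<le> schwartz_norm j f + schwartz_norm j g"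
  using schwartz_norm_add[OF _ schwartz_uminus, of f g j] by (simp add: schwartz_norm_uminus)

lemma schwartz_differentiable: "schwartz f \<Longrightarrow> f differentiable (at x)"
  using smoothD[of f "[]" x] by (simp add: schwartz_def partial_derivs_Nil)

lemma schwartz_continuous: "schwartz f \<Longrightarrow> continuous_on UNIV f"
  using schwartz_differentiable
  by (metis continuous_at_imp_continuous_on differentiable_imp_continuous_within)

lemma schwartz_measurable: "schwartz f \<Longrightarrow> f \<in> borel_measurable borel"
  by (rule borel_measurable_continuous_onI) (rule schwartz_continuous)

lemma schwartz_lipschitz:
  fixes f :: "real^'n::finite \<Rightarrow> complex"
  assumes "schwartz f"
  shows "norm (f x - f y) \<le> real CARD('n) * schwartz_norm 1 f * norm (x - y)"
proof -
  obtain f' where f': "\<And>x. (f has_derivative f' x) (at x)"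
    using schwartz_differentiable[OF assms] unfolding differentiable_def by metis
  have "norm (f' x h) \<le> (real CARD('n) * schwartz_norm 1 f) * norm h" for x h
  proof -
    interpret linear "f' x" using f' by (rule has_derivative_linear)
    have "f' x h = f' x (\<Sum>i\<in>UNIV. (h $ i) *\<^sub>R axis i 1)"
      by (simp add: basis_expansion scalar_mult_eq_scaleR[symmetric])
    also have "\<dots> = (\<Sum>i\<in>UNIV. (h $ i) *\<^sub>R partial_deriv i f x)"
      by (simp add: sum scale partial_deriv_eq[OF f'])
    also have "norm \<dots> \<le> (\<Sum>i\<in>(UNIV::'n set). norm h * schwartz_norm 1 f)"
    proof (rule sum_norm_le)
      fix i :: 'n
      have "norm (partial_deriv i f x) \<le> (1 + norm x) ^ 1 * norm (partial_deriv i f x)"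
        by (simp add: distrib_right)
      also have "\<dots> \<le> schwartz_norm 1 f"
        using schwartz_norm_upper[OF assms, of "\<lambda>j. if j = i then 1 else 0" 1 x]
        unfolding multi_deriv_1 by simp
      finally show "norm ((h $ i) *\<^sub>R partial_deriv i f x) \<le> norm h * schwartz_norm 1 f"
        unfolding norm_scaleR
        by (intro mult_mono) (auto simp: component_le_norm_cart)
    qed
    finally show ?thesis by (simp add: mult_ac)
  qed
  then have "onorm (f' x) \<le> real CARD('n) * schwartz_norm 1 f" for x
    using schwartz_norm_nonneg[OF assms, of 1] by (intro onorm_bound) auto
  then show ?thesis
    by (intro differentiable_bound[of UNIV f f']) (auto simp: f' has_derivative_at_withinI)
qed

lemma integrable_weight:
  "integrable lborel (\<lambda>y::real^'n::finite. 1 / (1 + norm y) ^ (CARD('n) + 2))"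
proof (rule integrableI_bounded)
  let ?n = "CARD('n)"
  let ?V = "unit_ball_vol (real ?n)"
  let ?B = "\<lambda>m::nat. cball (0::real^'n) (real (Suc m))"
  let ?g = "\<lambda>m (y::real^'n). ennreal (1 / real (Suc m) ^ (?n + 2)) * indicator (?B m) y"
  show "(\<lambda>y::real^'n. 1 / (1 + norm y) ^ (?n + 2)) \<in> borel_measurable lborel"
    by measurable
  have *: "ennreal (norm (1 / (1 + norm y) ^ (?n + 2))) \<le> (\<Sum>m. ?g m y)" for y :: "real^'n"
  proof -
    define m where "m = nat \<lfloor>norm y\<rfloor>"
    have m: "real m \<le> norm y" "norm y \<le> real (Suc m)"
      unfolding m_def by (simp_all add: of_nat_floor) linarith
    have "1 / (1 + norm y) ^ (?n + 2) \<le> 1 / real (Suc m) ^ (?n + 2)"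
      using m by (intro divide_left_mono power_mono mult_pos_pos zero_less_power)
        (auto simp: add_pos_nonneg)
    then have "ennreal (norm (1 / (1 + norm y) ^ (?n + 2))) \<le> ?g m y"
      using m by (auto simp: indicator_def intro!: ennreal_leI)
    also have "\<dots> \<le> (\<Sum>k<Suc m. ?g k y)"
      by (rule member_le_sum) auto
    also have "\<dots> \<le> (\<Sum>k. ?g k y)" by (rule sum_le_suminf) auto
    finally show ?thesis .
  qed
  have [measurable]: "?B m \<in> sets borel" for m by simp
  have "(\<integral>\<^sup>+ y. ennreal (norm (1 / (1 + norm (y::real^'n)) ^ (?n + 2))) \<partial>lborel)
      \<le> (\<integral>\<^sup>+ y. (\<Sum>m. ?g m y) \<partial>lborel)"
    by (intro nn_integral_mono *)
  also have "\<dots> = (\<Sum>m. \<integral>\<^sup>+ y. ?g m y \<partial>lborel)"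
    by (rule nn_integral_suminf) measurable
  also have "\<dots> = (\<Sum>m. ennreal (?V * (1 / real (Suc m) ^ 2)))"
  proof (rule arg_cong[of _ _ suminf], rule ext)
    fix m
    have "(\<integral>\<^sup>+ y. ?g m y \<partial>lborel) = ennreal (1 / real (Suc m) ^ (?n + 2)) * emeasure lborel (?B m)"
      by (subst nn_integral_cmult_indicator) auto
    also have "\<dots> = ennreal (1 / real (Suc m) ^ (?n + 2)) * ennreal (?V * real (Suc m) ^ ?n)"
      by (subst emeasure_cball) auto
    also have "\<dots> = ennreal (?V * (1 / real (Suc m) ^ 2))"
      by (subst ennreal_mult[symmetric]) (auto simp: field_simps power_add power2_eq_square simp del: of_nat_Suc)
    finally show "(\<integral>\<^sup>+ y. ?g m y \<partial>lborel) = ennreal (?V * (1 / real (Suc m) ^ 2))" .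
  qed
  also have "\<dots> < \<infinity>"
  proof -
    have "summable (\<lambda>m. 1 / real (Suc m) ^ 2)"
      using inverse_power_summable[of 2, where 'a=real] by (subst summable_Suc_iff) (simp add: inverse_eq_divide)
    then have "summable (\<lambda>m. ?V * (1 / real (Suc m) ^ 2))" by (rule summable_mult)
    then show ?thesis by (subst suminf_ennreal2) auto
  qed
  finally show "(\<integral>\<^sup>+ y. ennreal (norm (1 / (1 + norm (y::real^'n)) ^ (?n + 2))) \<partial>lborel) < \<infinity>" .
qed

lemma
  fixes f g :: "real^'n::finite \<Rightarrow> complex"
  assumes "schwartz f" "schwartz g"
  shows schwartz_integrable_mult: "integrable lborel (\<lambda>y. f y * g y)"
    and schwartz_integral_bound: "norm (\<integral>y. f y * g y \<partial>lborel)
      \<le> (\<integral>y. 1 / (1 + norm (y::real^'n)) ^ (CARD('n) + 2) \<partial>lborel) * (schwartz_norm 0 f * schwartz_norm (CARD('n) + 2) g)"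
proof -
  let ?w = "\<lambda>y::real^'n. 1 / (1 + norm y) ^ (CARD('n) + 2)"
  let ?C = "schwartz_norm 0 f * schwartz_norm (CARD('n) + 2) g"
  have bnd: "norm (f y * g y) \<le> ?w y * ?C" for y
  proof -
    have "norm (g y) \<le> schwartz_norm (CARD('n) + 2) g / (1 + norm y) ^ (CARD('n) + 2)"
      using schwartz_norm_weight[OF assms(2), of y "CARD('n) + 2"]
      by (subst pos_le_divide_eq) (auto simp: mult.commute add_pos_nonneg simp del: power_add)
    with schwartz_norm_0_upper[OF assms(1), of y]
    have "norm (f y) * norm (g y) \<le> schwartz_norm 0 f * (schwartz_norm (CARD('n) + 2) g / (1 + norm y) ^ (CARD('n) + 2))"
      by (intro mult_mono) (auto simp: schwartz_norm_nonneg assms)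
    then show ?thesis by (simp add: norm_mult)
  qed
  have iw: "integrable lborel (\<lambda>y. ?w y * ?C)"
    by (intro integrable_mult_left integrable_weight)
  note [measurable] = schwartz_measurable[OF assms(1)] schwartz_measurable[OF assms(2)]
  show i: "integrable lborel (\<lambda>y. f y * g y)"
    by (rule Bochner_Integration.integrable_bound[OF iw])
      (use order_trans[OF bnd abs_ge_self] in \<open>simp_all del: power_Suc power_add_numeral2 add_2_eq_Suc add_2_eq_Suc'\<close>)
  have "norm (\<integral>y. f y * g y \<partial>lborel) \<le> (\<integral>y. ?w y * ?C \<partial>lborel)"
    by (rule Bochner_Integration.integral_norm_bound_integral[OF i iw]) (rule bnd)
  also have "\<dots> = (\<integral>y. ?w y \<partial>lborel) * ?C"
    by (rule integral_mult_left_zero)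
  finally show "norm (\<integral>y. f y * g y \<partial>lborel) \<le> (\<integral>y. ?w y \<partial>lborel) * ?C" .
qed

section \<open>The space of generalized functions\<close>

definition ES :: "(real \<Rightarrow> real^'n \<Rightarrow> complex) set" where
  "ES = {u. (\<forall>\<epsilon>\<in>{0<..1}. schwartz (u \<epsilon>)) \<and> (\<forall>j. moderate (\<lambda>\<epsilon>. schwartz_norm j (u \<epsilon>)))}"

definition NS :: "(real \<Rightarrow> real^'n \<Rightarrow> complex) set" where
  "NS = {u. (\<forall>\<epsilon>\<in>{0<..1}. schwartz (u \<epsilon>)) \<and> (\<forall>j. negligible_net (\<lambda>\<epsilon>. schwartz_norm j (u \<epsilon>)))}"

definition GS_rel :: "(real \<Rightarrow> real^'n \<Rightarrow> complex) \<Rightarrow> (real \<Rightarrow> real^'n \<Rightarrow> complex) \<Rightarrow> bool" where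
  "GS_rel u v \<longleftrightarrow> u \<in> ES \<and> v \<in> ES \<and> (\<lambda>\<epsilon> y. u \<epsilon> y - v \<epsilon> y) \<in> NS"

lemma ES_I:
  assumes "\<And>\<epsilon>. \<epsilon> \<in> {0<..1} \<Longrightarrow> schwartz (u \<epsilon>)"
    and "\<And>j. moderate (r j)" "\<And>\<epsilon> j. \<epsilon> \<in> {0<..1} \<Longrightarrow> schwartz_norm j (u \<epsilon>) \<le> r j \<epsilon>"
  shows "u \<in> ES"
proof -
  have "moderate (\<lambda>\<epsilon>. schwartz_norm j (u \<epsilon>))" for j
    using assms(2)[of j]
  proof (rule moderate_le)
    fix \<epsilon> :: real assume e: "\<epsilon> \<in> {0<..1}"
    show "\<bar>schwartz_norm j (u \<epsilon>)\<bar> \<le> \<bar>r j \<epsilon>\<bar>"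
      using assms(3)[OF e, of j] schwartz_norm_nonneg[OF assms(1)[OF e], of j] by linarith
  qed
  with assms(1) show ?thesis by (simp add: ES_def)
qed

lemma NS_I:
  assumes "\<And>\<epsilon>. \<epsilon> \<in> {0<..1} \<Longrightarrow> schwartz (u \<epsilon>)"
    and "\<And>j. negligible_net (r j)" "\<And>\<epsilon> j. \<epsilon> \<in> {0<..1} \<Longrightarrow> schwartz_norm j (u \<epsilon>) \<le> r j \<epsilon>"
  shows "u \<in> NS"
proof -
  have "negligible_net (\<lambda>\<epsilon>. schwartz_norm j (u \<epsilon>))" for j
    using assms(2)[of j]
  proof (rule negligible_net_le)
    fix \<epsilon> :: real assume e: "\<epsilon> \<in> {0<..1}"
    show "\<bar>schwartz_norm j (u \<epsilon>)\<bar> \<le> \<bar>r j \<epsilon>\<bar>"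
      using assms(3)[OF e, of j] schwartz_norm_nonneg[OF assms(1)[OF e], of j] by linarith
  qed
  with assms(1) show ?thesis by (simp add: NS_def)
qed

lemma ES_D:
  "u \<in> ES \<Longrightarrow> \<epsilon> \<in> {0<..1} \<Longrightarrow> schwartz (u \<epsilon>)"
  "u \<in> ES \<Longrightarrow> moderate (\<lambda>\<epsilon>. schwartz_norm j (u \<epsilon>))"
  by (simp_all add: ES_def)

lemma NS_D:
  "u \<in> NS \<Longrightarrow> \<epsilon> \<in> {0<..1} \<Longrightarrow> schwartz (u \<epsilon>)"
  "u \<in> NS \<Longrightarrow> negligible_net (\<lambda>\<epsilon>. schwartz_norm j (u \<epsilon>))"
  by (simp_all add: NS_def)

lemma ES_add:
  assumes "u \<in> ES" "v \<in> ES" shows "(\<lambda>\<epsilon> y. u \<epsilon> y + v \<epsilon> y) \<in> ES"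
proof (rule ES_I[where r = "\<lambda>j \<epsilon>. schwartz_norm j (u \<epsilon>) + schwartz_norm j (v \<epsilon>)"])
  fix \<epsilon> :: real and j assume e: "\<epsilon> \<in> {0<..1}"
  show "schwartz (\<lambda>y. u \<epsilon> y + v \<epsilon> y)"
    by (intro schwartz_add ES_D(1)[OF assms(1) e] ES_D(1)[OF assms(2) e])
  show "schwartz_norm j (\<lambda>y. u \<epsilon> y + v \<epsilon> y) \<le> schwartz_norm j (u \<epsilon>) + schwartz_norm j (v \<epsilon>)"
    by (intro schwartz_norm_add ES_D(1)[OF assms(1) e] ES_D(1)[OF assms(2) e])
next
  fix j
  show "moderate (\<lambda>\<epsilon>. schwartz_norm j (u \<epsilon>) + schwartz_norm j (v \<epsilon>))"
    by (intro moderate_add ES_D(2) assms)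
qed

lemma ES_uminus:
  assumes "u \<in> ES" shows "(\<lambda>\<epsilon> y. - u \<epsilon> y) \<in> ES"
proof (rule ES_I[where r = "\<lambda>j \<epsilon>. schwartz_norm j (u \<epsilon>)"])
  fix \<epsilon> :: real and j assume e: "\<epsilon> \<in> {0<..1}"
  show "schwartz (\<lambda>y. - u \<epsilon> y)"
    by (intro schwartz_uminus ES_D(1)[OF assms e])
  show "schwartz_norm j (\<lambda>y. - u \<epsilon> y) \<le> schwartz_norm j (u \<epsilon>)"
    by (intro eq_refl schwartz_norm_uminus ES_D(1)[OF assms e])
next
  fix j
  show "moderate (\<lambda>\<epsilon>. schwartz_norm j (u \<epsilon>))"
    by (intro ES_D(2) assms)
qed

lemma NS_add:
  assumes "u \<in> NS" "v \<in> NS" shows "(\<lambda>\<epsilon> y. u \<epsilon> y + v \<epsilon> y) \<in> NS"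
proof (rule NS_I[where r = "\<lambda>j \<epsilon>. schwartz_norm j (u \<epsilon>) + schwartz_norm j (v \<epsilon>)"])
  fix \<epsilon> :: real and j assume e: "\<epsilon> \<in> {0<..1}"
  show "schwartz (\<lambda>y. u \<epsilon> y + v \<epsilon> y)"
    by (intro schwartz_add NS_D(1)[OF assms(1) e] NS_D(1)[OF assms(2) e])
  show "schwartz_norm j (\<lambda>y. u \<epsilon> y + v \<epsilon> y) \<le> schwartz_norm j (u \<epsilon>) + schwartz_norm j (v \<epsilon>)"
    by (intro schwartz_norm_add NS_D(1)[OF assms(1) e] NS_D(1)[OF assms(2) e])
next
  fix j
  show "negligible_net (\<lambda>\<epsilon>. schwartz_norm j (u \<epsilon>) + schwartz_norm j (v \<epsilon>))"
    by (intro negligible_net_add NS_D(2) assms)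
qed

lemma NS_uminus:
  assumes "u \<in> NS" shows "(\<lambda>\<epsilon> y. - u \<epsilon> y) \<in> NS"
proof (rule NS_I[where r = "\<lambda>j \<epsilon>. schwartz_norm j (u \<epsilon>)"])
  fix \<epsilon> :: real and j assume e: "\<epsilon> \<in> {0<..1}"
  show "schwartz (\<lambda>y. - u \<epsilon> y)"
    by (intro schwartz_uminus NS_D(1)[OF assms e])
  show "schwartz_norm j (\<lambda>y. - u \<epsilon> y) \<le> schwartz_norm j (u \<epsilon>)"
    by (intro eq_refl schwartz_norm_uminus NS_D(1)[OF assms e])
next
  fix j
  show "negligible_net (\<lambda>\<epsilon>. schwartz_norm j (u \<epsilon>))"
    by (intro NS_D(2) assms)
qed

lemma NS_zero: "(\<lambda>_ _. 0) \<in> NS"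
  by (simp add: NS_def schwartz_zero schwartz_norm_zero negligible_net_0)

lemma ES_zero: "(\<lambda>_ _. 0) \<in> ES"
  by (simp add: ES_def schwartz_zero schwartz_norm_zero moderate_const)

lemma ES_scale:
  assumes "z \<in> moderate_nets" "u \<in> ES" shows "(\<lambda>\<epsilon> y. z \<epsilon> * u \<epsilon> y) \<in> ES"
proof (rule ES_I[where r = "\<lambda>j \<epsilon>. norm (z \<epsilon>) * schwartz_norm j (u \<epsilon>)"])
  fix \<epsilon> :: real and j assume e: "\<epsilon> \<in> {0<..1}"
  show "schwartz (\<lambda>y. z \<epsilon> * u \<epsilon> y)"
    by (intro schwartz_cmult ES_D(1)[OF assms(2) e])
  show "schwartz_norm j (\<lambda>y. z \<epsilon> * u \<epsilon> y) \<le> norm (z \<epsilon>) * schwartz_norm j (u \<epsilon>)"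
    by (intro schwartz_norm_cmult ES_D(1)[OF assms(2) e])
next
  fix j
  show "moderate (\<lambda>\<epsilon>. norm (z \<epsilon>) * schwartz_norm j (u \<epsilon>))"
    proof (rule moderate_mult)
    show "moderate (\<lambda>\<epsilon>. norm (z \<epsilon>))" using assms(1) by (simp add: moderate_nets_def)
    show "moderate (\<lambda>\<epsilon>. schwartz_norm j (u \<epsilon>))"
      by (rule ES_D(2)[OF assms(2)])
  qed
qed

lemma NS_scale:
  assumes "z \<in> moderate_nets" "u \<in> NS" shows "(\<lambda>\<epsilon> y. z \<epsilon> * u \<epsilon> y) \<in> NS"
proof (rule NS_I[where r = "\<lambda>j \<epsilon>. norm (z \<epsilon>) * schwartz_norm j (u \<epsilon>)"])
  fix \<epsilon> :: real and j assume e: "\<epsilon> \<in> {0<..1}"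
  show "schwartz (\<lambda>y. z \<epsilon> * u \<epsilon> y)"
    by (intro schwartz_cmult NS_D(1)[OF assms(2) e])
  show "schwartz_norm j (\<lambda>y. z \<epsilon> * u \<epsilon> y) \<le> norm (z \<epsilon>) * schwartz_norm j (u \<epsilon>)"
    by (intro schwartz_norm_cmult NS_D(1)[OF assms(2) e])
next
  fix j
  show "negligible_net (\<lambda>\<epsilon>. norm (z \<epsilon>) * schwartz_norm j (u \<epsilon>))"
    proof (rule negligible_net_mult')
    show "moderate (\<lambda>\<epsilon>. norm (z \<epsilon>))" using assms(1) by (simp add: moderate_nets_def)
    show "negligible_net (\<lambda>\<epsilon>. schwartz_norm j (u \<epsilon>))"
      by (rule NS_D(2)[OF assms(2)])
  qed
qed

lemma NS_scale':
  assumes "negligible_net (\<lambda>\<epsilon>. norm (z \<epsilon>))" "u \<in> ES" shows "(\<lambda>\<epsilon> y. z \<epsilon> * u \<epsilon> y) \<in> NS"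
proof (rule NS_I[where r = "\<lambda>j \<epsilon>. norm (z \<epsilon>) * schwartz_norm j (u \<epsilon>)"])
  fix \<epsilon> :: real and j assume e: "\<epsilon> \<in> {0<..1}"
  show "schwartz (\<lambda>y. z \<epsilon> * u \<epsilon> y)"
    by (intro schwartz_cmult ES_D(1)[OF assms(2) e])
  show "schwartz_norm j (\<lambda>y. z \<epsilon> * u \<epsilon> y) \<le> norm (z \<epsilon>) * schwartz_norm j (u \<epsilon>)"
    by (intro schwartz_norm_cmult ES_D(1)[OF assms(2) e])
next
  fix j
  show "negligible_net (\<lambda>\<epsilon>. norm (z \<epsilon>) * schwartz_norm j (u \<epsilon>))"
    proof (rule negligible_net_mult)
    show "negligible_net (\<lambda>\<epsilon>. norm (z \<epsilon>))" by (rule assms(1))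
    show "moderate (\<lambda>\<epsilon>. schwartz_norm j (u \<epsilon>))"
      by (rule ES_D(2)[OF assms(2)])
  qed
qed

lemma GS_rel_refl: "GS_rel u u \<longleftrightarrow> u \<in> ES"
  by (simp add: GS_rel_def NS_zero)

lemma GS_rel_sym: "GS_rel u v \<Longrightarrow> GS_rel v u"
  unfolding GS_rel_def by (auto dest: NS_uminus)

lemma GS_rel_part_equivp: "part_equivp GS_rel"
proof (rule part_equivpI)
  show "\<exists>u::real \<Rightarrow> real^'n \<Rightarrow> complex. GS_rel u u"
    using ES_zero GS_rel_refl by blast
  show "symp (GS_rel :: (real \<Rightarrow> real^'n \<Rightarrow> complex) \<Rightarrow> _)"
    by (rule sympI) (rule GS_rel_sym)
  show "transp (GS_rel :: (real \<Rightarrow> real^'n \<Rightarrow> complex) \<Rightarrow> _)"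
  proof (rule transpI)
    fix u v w :: "real \<Rightarrow> real^'n \<Rightarrow> complex" assume "GS_rel u v" "GS_rel v w"
    then show "GS_rel u w"
      using NS_add[of "\<lambda>\<epsilon> y. u \<epsilon> y - v \<epsilon> y" "\<lambda>\<epsilon> y. v \<epsilon> y - w \<epsilon> y"] by (simp add: GS_rel_def)
  qed
qed

quotient_type (overloaded) 'n GS = "real \<Rightarrow> real^'n::finite \<Rightarrow> complex" / partial: GS_rel
  morphisms rep_GS GS_of
  by (rule GS_rel_part_equivp)

instantiation GS :: (finite) ab_group_add
begin

lift_definition zero_GS :: "'a GS" is "\<lambda>_ _. 0"
  by (simp add: GS_rel_refl ES_zero)

lift_definition plus_GS :: "'a GS \<Rightarrow> 'a GS \<Rightarrow> 'a GS" is "\<lambda>u v \<epsilon> y. u \<epsilon> y + v \<epsilon> y"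
proof -
  fix u u' v v' :: "real \<Rightarrow> real^'a \<Rightarrow> complex" assume "GS_rel u u'" "GS_rel v v'"
  then show "GS_rel (\<lambda>\<epsilon> y. u \<epsilon> y + v \<epsilon> y) (\<lambda>\<epsilon> y. u' \<epsilon> y + v' \<epsilon> y)"
    using NS_add[of "\<lambda>\<epsilon> y. u \<epsilon> y - u' \<epsilon> y" "\<lambda>\<epsilon> y. v \<epsilon> y - v' \<epsilon> y"]
    by (simp add: GS_rel_def ES_add algebra_simps)
qed

lift_definition uminus_GS :: "'a GS \<Rightarrow> 'a GS" is "\<lambda>u \<epsilon> y. - u \<epsilon> y"
  unfolding GS_rel_def by (auto simp: ES_uminus dest: NS_uminus)

definition minus_GS :: "'a GS \<Rightarrow> 'a GS \<Rightarrow> 'a GS" where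
  "minus_GS u v = u + - v"

instance
proof
  fix a b c :: "'a GS"
  show "a + b + c = a + (b + c)"
    by transfer (auto simp: add.assoc GS_rel_refl intro: ES_add)
  show "a + b = b + a"
    by transfer (auto simp: add.commute GS_rel_refl intro: ES_add)
  show "0 + a = a" by transfer (simp add: GS_rel_refl)
  show "- a + a = 0" by transfer (simp add: GS_rel_refl ES_zero)
  show "a - b = a + - b" by (rule minus_GS_def)
qed

end

lift_definition GS_scale :: "complex gen \<Rightarrow> 'n::finite GS \<Rightarrow> 'n GS" is "\<lambda>z u \<epsilon> y. z \<epsilon> * u \<epsilon> y"
proof -
  fix z z' :: "real \<Rightarrow> complex" and u u' :: "real \<Rightarrow> real^'n \<Rightarrow> complex" assume a: "gen_rel z z'" "GS_rel u u'"
  have "(\<lambda>\<epsilon> y. (z \<epsilon> - z' \<epsilon>) * u \<epsilon> y + z' \<epsilon> * (u \<epsilon> y - u' \<epsilon> y)) \<in> NS"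
    by (rule NS_add[OF NS_scale' NS_scale]) (use a in \<open>simp_all add: gen_rel_def GS_rel_def\<close>)
  with a show "GS_rel (\<lambda>\<epsilon> y. z \<epsilon> * u \<epsilon> y) (\<lambda>\<epsilon> y. z' \<epsilon> * u' \<epsilon> y)"
    by (simp add: GS_rel_def gen_rel_def ES_scale algebra_simps)
qed

interpretation GS: module GS_scale
proof
  fix a b and x y :: "'n::finite GS"
  show "GS_scale a (x + y) = GS_scale a x + GS_scale a y"
    by transfer (auto simp: GS_rel_refl gen_rel_refl distrib_left intro: ES_add ES_scale)
  show "GS_scale (a + b) x = GS_scale a x + GS_scale b x"
    by transfer (auto simp: GS_rel_refl gen_rel_refl distrib_right intro: ES_add ES_scale)
  show "GS_scale a (GS_scale b x) = GS_scale (a * b) x"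
    by transfer (auto simp: GS_rel_refl gen_rel_refl mult.assoc intro: ES_scale)
  show "GS_scale 1 x = x"
    by transfer (auto simp: GS_rel_refl)
qed

lift_definition GS_norm :: "nat \<Rightarrow> 'n::finite GS \<Rightarrow> real" is
  "\<lambda>j u. sharp_norm (\<lambda>\<epsilon>. schwartz_norm j (u \<epsilon>))"
proof -
  have le: "bigO_pow (\<lambda>\<epsilon>. schwartz_norm j (v \<epsilon>)) b"
    if a: "GS_rel u v" "bigO_pow (\<lambda>\<epsilon>. schwartz_norm j (u \<epsilon>)) b"
    for u v :: "real \<Rightarrow> real^'n \<Rightarrow> complex" and b j
  proof -
    have "bigO_pow (\<lambda>\<epsilon>. schwartz_norm j (u \<epsilon>) + schwartz_norm j (\<lambda>y. u \<epsilon> y - v \<epsilon> y)) b"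
      using that by (intro bigO_pow_add) (auto simp: GS_rel_def NS_def negligible_bigO_pow)
    then show ?thesis
    proof (rule bigO_pow_le)
      fix \<epsilon> :: real assume "\<epsilon> \<in> {0<..1}"
      then have s: "schwartz (u \<epsilon>)" "schwartz (v \<epsilon>)" "schwartz (\<lambda>y. u \<epsilon> y - v \<epsilon> y)"
        using a by (auto simp: GS_rel_def ES_def NS_def)
      from schwartz_norm_diff[OF s(1,3), of j] s
      show "\<bar>schwartz_norm j (v \<epsilon>)\<bar> \<le> \<bar>schwartz_norm j (u \<epsilon>) + schwartz_norm j (\<lambda>y. u \<epsilon> y - v \<epsilon> y)\<bar>"
        by (simp add: schwartz_norm_nonneg)
    qed
  qed
  fix j and u v :: "real \<Rightarrow> real^'n \<Rightarrow> complex" assume "GS_rel u v"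
  with GS_rel_sym le have "sharp_val (\<lambda>\<epsilon>. schwartz_norm j (u \<epsilon>)) = sharp_val (\<lambda>\<epsilon>. schwartz_norm j (v \<epsilon>))"
    by (intro sharp_val_eqI) blast
  then show "sharp_norm (\<lambda>\<epsilon>. schwartz_norm j (u \<epsilon>)) = sharp_norm (\<lambda>\<epsilon>. schwartz_norm j (v \<epsilon>))"
    by (simp add: sharp_norm_def)
qed

text \<open>Point values \<open>u(x)\<close>; as a function of \<open>u\<close>, \<open>GS_delta x\<close> is the functional \<open>\<delta>\<^sub>x\<close>.\<close>

lift_definition GS_delta :: "(real^'n) gen \<Rightarrow> 'n::finite GS \<Rightarrow> complex gen" is
  "\<lambda>x u \<epsilon>. u \<epsilon> (x \<epsilon>)"
proof -
  have mod: "(\<lambda>\<epsilon>. u \<epsilon> (x \<epsilon>)) \<in> moderate_nets" if "u \<in> ES" for u :: "real \<Rightarrow> real^'n \<Rightarrow> complex" and x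
    unfolding moderate_nets_def mem_Collect_eq
    by (rule moderate_le[of "\<lambda>\<epsilon>. schwartz_norm 0 (u \<epsilon>)"])
      (use that in \<open>auto simp: ES_def schwartz_norm_nonneg schwartz_norm_0_upper\<close>)
  fix x x' :: "real \<Rightarrow> real^'n" and u u' :: "real \<Rightarrow> real^'n \<Rightarrow> complex" assume a: "gen_rel x x'" "GS_rel u u'"
  then have s: "schwartz (u \<epsilon>)" "schwartz (\<lambda>y. u \<epsilon> y - u' \<epsilon> y)" if "\<epsilon> \<in> {0<..1}" for \<epsilon>
    using that by (auto simp: GS_rel_def ES_def NS_def)
  have "negligible_net (\<lambda>\<epsilon>. real CARD('n) * schwartz_norm 1 (u \<epsilon>) * norm (x \<epsilon> - x' \<epsilon>)
      + schwartz_norm 0 (\<lambda>y. u \<epsilon> y - u' \<epsilon> y))"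
  proof (rule negligible_net_add)
    have "moderate (\<lambda>\<epsilon>. schwartz_norm 1 (u \<epsilon>))"
      using a by (simp add: GS_rel_def ES_D)
    then show "negligible_net (\<lambda>\<epsilon>. real CARD('n) * schwartz_norm 1 (u \<epsilon>) * norm (x \<epsilon> - x' \<epsilon>))"
      using a by (intro negligible_net_mult'[OF moderate_mult[OF moderate_const]]) (simp_all add: gen_rel_def)
    show "negligible_net (\<lambda>\<epsilon>. schwartz_norm 0 (\<lambda>y. u \<epsilon> y - u' \<epsilon> y))"
      using a NS_D(2) by (simp add: GS_rel_def NS_def)
  qed
  then have "negligible_net (\<lambda>\<epsilon>. norm (u \<epsilon> (x \<epsilon>) - u' \<epsilon> (x' \<epsilon>)))"
  proof (rule negligible_net_le)
    fix \<epsilon> :: real assume e: "\<epsilon> \<in> {0<..1}"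
    have "norm (u \<epsilon> (x \<epsilon>) - u' \<epsilon> (x' \<epsilon>)) \<le> norm (u \<epsilon> (x \<epsilon>) - u \<epsilon> (x' \<epsilon>)) + norm (u \<epsilon> (x' \<epsilon>) - u' \<epsilon> (x' \<epsilon>))"
      by (metis add_diff_eq diff_add_cancel norm_triangle_ineq)
    then show "\<bar>norm (u \<epsilon> (x \<epsilon>) - u' \<epsilon> (x' \<epsilon>))\<bar> \<le> \<bar>real CARD('n) * schwartz_norm 1 (u \<epsilon>) * norm (x \<epsilon> - x' \<epsilon>)
      + schwartz_norm 0 (\<lambda>y. u \<epsilon> y - u' \<epsilon> y)\<bar>"
      using schwartz_lipschitz[OF s(1)[OF e], of "x \<epsilon>" "x' \<epsilon>"]
        schwartz_norm_0_upper[OF s(2)[OF e], of "x' \<epsilon>"] by simp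
  qed
  with a show "gen_rel (\<lambda>\<epsilon>. u \<epsilon> (x \<epsilon>)) (\<lambda>\<epsilon>. u' \<epsilon> (x' \<epsilon>))"
    by (simp add: gen_rel_def mod GS_rel_def)
qed

text \<open>An element \<open>v\<close>, regarded as the functional \<open>u \<mapsto> \<integral> v(y) u(y) dy\<close>.\<close>

lift_definition GS_functional :: "'n::finite GS \<Rightarrow> 'n GS \<Rightarrow> complex gen" is
  "\<lambda>v u \<epsilon>. \<integral>y. v \<epsilon> y * u \<epsilon> y \<partial>lborel"
proof -
  define K where "K = (\<integral>y. 1 / (1 + norm (y::real^'n)) ^ (CARD('n) + 2) \<partial>lborel)"
  let ?p = "\<lambda>u \<epsilon>. schwartz_norm 0 (u \<epsilon> :: real^'n \<Rightarrow> complex)"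
  let ?r = "\<lambda>u \<epsilon>. schwartz_norm (CARD('n) + 2) (u \<epsilon> :: real^'n \<Rightarrow> complex)"
  have bnd: "norm (\<integral>y. f y * g y \<partial>lborel) \<le> K * (schwartz_norm 0 f * schwartz_norm (CARD('n) + 2) g)"
    if "schwartz f" "schwartz g" for f g :: "real^'n \<Rightarrow> complex"
    using schwartz_integral_bound[OF that] by (simp add: K_def)
  have mod: "(\<lambda>\<epsilon>. \<integral>y. v \<epsilon> y * u \<epsilon> y \<partial>lborel) \<in> moderate_nets"
    if "v \<in> ES" "u \<in> ES" for u v :: "real \<Rightarrow> real^'n \<Rightarrow> complex"
  proof -
    have "moderate (\<lambda>\<epsilon>. K * (?p v \<epsilon> * ?r u \<epsilon>))"
      using that by (intro moderate_mult[OF moderate_const] moderate_mult[OF ES_D(2) ES_D(2)])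
    then show ?thesis
      unfolding moderate_nets_def mem_Collect_eq
    proof (rule moderate_le)
      fix \<epsilon> :: real assume e: "\<epsilon> \<in> {0<..1}"
      show "\<bar>norm (\<integral>y. v \<epsilon> y * u \<epsilon> y \<partial>lborel)\<bar> \<le> \<bar>K * (?p v \<epsilon> * ?r u \<epsilon>)\<bar>"
        unfolding abs_norm_cancel
        by (rule order_trans[OF bnd[OF ES_D(1)[OF that(1) e] ES_D(1)[OF that(2) e]] abs_ge_self])
    qed
  qed
  fix v v' u u' :: "real \<Rightarrow> real^'n \<Rightarrow> complex" assume a: "GS_rel v v'" "GS_rel u u'"
  let ?dv = "\<lambda>\<epsilon> y. v \<epsilon> y - v' \<epsilon> y" and ?du = "\<lambda>\<epsilon> y. u \<epsilon> y - u' \<epsilon> y"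
  have "negligible_net (\<lambda>\<epsilon>. K * (?p ?dv \<epsilon> * ?r u \<epsilon>) + K * (?p v' \<epsilon> * ?r ?du \<epsilon>))"
  proof (rule negligible_net_add)
    have 1: "negligible_net (?p ?dv)" "moderate (?r u)" "moderate (?p v')" "negligible_net (?r ?du)"
      using a by (simp_all add: GS_rel_def ES_def NS_def)
    show "negligible_net (\<lambda>\<epsilon>. K * (?p ?dv \<epsilon> * ?r u \<epsilon>))"
      by (rule negligible_net_mult'[OF moderate_const negligible_net_mult[OF 1(1,2)]])
    show "negligible_net (\<lambda>\<epsilon>. K * (?p v' \<epsilon> * ?r ?du \<epsilon>))"
      by (rule negligible_net_mult'[OF moderate_const negligible_net_mult'[OF 1(3,4)]])
  qed
  then have "negligible_net (\<lambda>\<epsilon>. norm ((\<integral>y. v \<epsilon> y * u \<epsilon> y \<partial>lborel) - (\<integral>y. v' \<epsilon> y * u' \<epsilon> y \<partial>lborel)))"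
  proof (rule negligible_net_le)
    fix \<epsilon> :: real assume "\<epsilon> \<in> {0<..1}"
    then have s: "schwartz (v \<epsilon>)" "schwartz (v' \<epsilon>)" "schwartz (u \<epsilon>)" "schwartz (u' \<epsilon>)"
      "schwartz (?dv \<epsilon>)" "schwartz (?du \<epsilon>)"
      using a by (auto simp: GS_rel_def ES_def NS_def)
    have "(\<integral>y. v \<epsilon> y * u \<epsilon> y \<partial>lborel) - (\<integral>y. v' \<epsilon> y * u' \<epsilon> y \<partial>lborel) =
        (\<integral>y. v \<epsilon> y * u \<epsilon> y - v' \<epsilon> y * u' \<epsilon> y \<partial>lborel)"
      by (intro Bochner_Integration.integral_diff[symmetric] schwartz_integrable_mult s)
    also have "\<dots> = (\<integral>y. ?dv \<epsilon> y * u \<epsilon> y + v' \<epsilon> y * ?du \<epsilon> y \<partial>lborel)"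
      by (simp add: algebra_simps)
    also have "\<dots> = (\<integral>y. ?dv \<epsilon> y * u \<epsilon> y \<partial>lborel) + (\<integral>y. v' \<epsilon> y * ?du \<epsilon> y \<partial>lborel)"
      by (intro Bochner_Integration.integral_add schwartz_integrable_mult s)
    finally have *: "norm ((\<integral>y. v \<epsilon> y * u \<epsilon> y \<partial>lborel) - (\<integral>y. v' \<epsilon> y * u' \<epsilon> y \<partial>lborel))
        \<le> norm (\<integral>y. ?dv \<epsilon> y * u \<epsilon> y \<partial>lborel) + norm (\<integral>y. v' \<epsilon> y * ?du \<epsilon> y \<partial>lborel)"
      by (simp add: norm_triangle_ineq)
    show "\<bar>norm ((\<integral>y. v \<epsilon> y * u \<epsilon> y \<partial>lborel) - (\<integral>y. v' \<epsilon> y * u' \<epsilon> y \<partial>lborel))\<bar>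
        \<le> \<bar>K * (?p ?dv \<epsilon> * ?r u \<epsilon>) + K * (?p v' \<epsilon> * ?r ?du \<epsilon>)\<bar>"
      unfolding abs_norm_cancel
      by (rule order_trans[OF order_trans[OF * add_mono[OF bnd[OF s(5,3)] bnd[OF s(2,6)]]] abs_ge_self])
  qed
  with a show "gen_rel (\<lambda>\<epsilon>. \<integral>y. v \<epsilon> y * u \<epsilon> y \<partial>lborel) (\<lambda>\<epsilon>. \<integral>y. v' \<epsilon> y * u' \<epsilon> y \<partial>lborel)"
    by (simp add: gen_rel_def mod GS_rel_def)
qed

section \<open>Topologies\<close>

definition topology_of_pseudometrics ::
  "'a set \<Rightarrow> 'i set \<Rightarrow> ('i \<Rightarrow> 'a \<Rightarrow> 'a \<Rightarrow> ennreal) \<Rightarrow> 'a topology" where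
  "topology_of_pseudometrics S I d = topology (\<lambda>U. U \<subseteq> S \<and>
     (\<forall>x\<in>U. \<exists>F r. finite F \<and> F \<subseteq> I \<and> 0 < r \<and> (\<forall>y\<in>S. (\<forall>i\<in>F. d i x y < r) \<longrightarrow> y \<in> U)))"

lemma openin_topology_of_pseudometrics:
  "openin (topology_of_pseudometrics S I d) U \<longleftrightarrow> U \<subseteq> S \<and>
     (\<forall>x\<in>U. \<exists>F r. finite F \<and> F \<subseteq> I \<and> 0 < r \<and> (\<forall>y\<in>S. (\<forall>i\<in>F. d i x y < r) \<longrightarrow> y \<in> U))"
proof -
  have "istopology (\<lambda>U. U \<subseteq> S \<and>
     (\<forall>x\<in>U. \<exists>F r. finite F \<and> F \<subseteq> I \<and> 0 < r \<and> (\<forall>y\<in>S. (\<forall>i\<in>F. d i x y < r) \<longrightarrow> y \<in> U)))"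
    (is "istopology ?op")
    unfolding istopology_def
  proof (intro conjI allI impI)
    fix U V assume U: "?op U" and V: "?op V"
    show "U \<inter> V \<subseteq> S" using U by blast
    show "\<forall>x\<in>U \<inter> V. \<exists>F r. finite F \<and> F \<subseteq> I \<and> 0 < r \<and> (\<forall>y\<in>S. (\<forall>i\<in>F. d i x y < r) \<longrightarrow> y \<in> U \<inter> V)"
    proof
      fix x assume x: "x \<in> U \<inter> V"
      obtain F r where F: "finite F" "F \<subseteq> I" "0 < r" "\<forall>y\<in>S. (\<forall>i\<in>F. d i x y < r) \<longrightarrow> y \<in> U"
        using U x by blast
      obtain G s where G: "finite G" "G \<subseteq> I" "0 < s" "\<forall>y\<in>S. (\<forall>i\<in>G. d i x y < s) \<longrightarrow> y \<in> V"
        using V x by blast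
      from F G show "\<exists>F r. finite F \<and> F \<subseteq> I \<and> 0 < r \<and> (\<forall>y\<in>S. (\<forall>i\<in>F. d i x y < r) \<longrightarrow> y \<in> U \<inter> V)"
        by (intro exI[of _ "F \<union> G"] exI[of _ "min r s"]) auto
    qed
  next
    fix K assume K: "\<forall>U\<in>K. ?op U"
    show "\<Union>K \<subseteq> S" using K by blast
    show "\<forall>x\<in>\<Union>K. \<exists>F r. finite F \<and> F \<subseteq> I \<and> 0 < r \<and> (\<forall>y\<in>S. (\<forall>i\<in>F. d i x y < r) \<longrightarrow> y \<in> \<Union>K)"
    proof
      fix x assume "x \<in> \<Union>K"
      then obtain U where "U \<in> K" "x \<in> U" by blast
      then obtain F r where "finite F" "F \<subseteq> I" "0 < r" "\<forall>y\<in>S. (\<forall>i\<in>F. d i x y < r) \<longrightarrow> y \<in> U"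
        using K by meson
      with \<open>U \<in> K\<close> show "\<exists>F r. finite F \<and> F \<subseteq> I \<and> 0 < r \<and> (\<forall>y\<in>S. (\<forall>i\<in>F. d i x y < r) \<longrightarrow> y \<in> \<Union>K)"
        by blast
    qed
  qed
  then show ?thesis by (simp add: topology_of_pseudometrics_def topology_inverse')
qed

lemma topspace_topology_of_pseudometrics [simp]: "topspace (topology_of_pseudometrics S I d) = S"
proof -
  have "openin (topology_of_pseudometrics S I d) S"
    unfolding openin_topology_of_pseudometrics by (auto intro!: exI[of _ "{}"] exI[of _ 1])
  then show ?thesis
    by (metis openin_subset openin_topology_of_pseudometrics openin_topspace subset_antisym)
qed

definition GS_topology :: "'n::finite GS topology" where
  "GS_topology = topology_of_pseudometrics UNIV UNIV (\<lambda>j u v. ennreal (GS_norm j (u - v)))"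

definition GS_bounded :: "'n::finite GS set \<Rightarrow> bool" where
  "GS_bounded B \<longleftrightarrow> (\<forall>j. bdd_above (GS_norm j ` B))"

definition GS_dual :: "('n::finite GS \<Rightarrow> complex gen) set" where
  "GS_dual = {T. module_hom GS_scale (*) T \<and> continuous_map GS_topology euclidean T}"

text \<open>The suprema are taken in \<^typ>\<open>ennreal\<close>, so that the empty bounded set contributes \<open>0\<close>.\<close>

definition GS_dual_topology :: "('n::finite GS \<Rightarrow> complex gen) topology" where
  "GS_dual_topology = topology_of_pseudometrics GS_dual (Collect GS_bounded)
     (\<lambda>B T S. SUP u\<in>B. ennreal (e_norm (T u - S u)))"

section \<open>Regularizations of the delta functional\<close>

definition rescale :: "real \<Rightarrow> (real^'n::finite \<Rightarrow> complex) \<Rightarrow> real^'n \<Rightarrow> complex" where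
  "rescale \<eta> \<rho> y = (1 / \<eta> ^ CARD('n)) *\<^sub>R \<rho> ((1 / \<eta>) *\<^sub>R y)"

definition regularization ::
  "(real \<Rightarrow> real^'n::finite) \<Rightarrow> (real^'n \<Rightarrow> complex) \<Rightarrow> nat \<Rightarrow> real \<Rightarrow> real^'n \<Rightarrow> complex" where
  "regularization x \<rho> q = (\<lambda>\<epsilon> y. rescale (\<epsilon> ^ q) \<rho> (x \<epsilon> - y))"

end

theory Submission
  imports Defs
begin

text \<open>
  Substituting \<open>y = x - \<epsilon>\<^sup>q z\<close> and using \<open>\<integral>\<rho> = 1\<close>, the error of the regularization at a test
  function \<open>u\<close> is \<open>\<integral>\<rho>(z) (u(x - \<epsilon>\<^sup>q z) - u(x)) dz\<close>. By the Lipschitz bound for \<open>u\<close> this is at most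
  \<open>C \<epsilon>\<^sup>q p\<^sub>1(u)\<close> with \<open>C\<close> depending only on \<open>\<rho>\<close>. Real constants are invisible to the sharp norm, so
  the error has sharp norm at most \<open>e\<^sup>-\<^sup>q P\<^sub>1(u)\<close>, uniformly small on bounded sets.
\<close>

section \<open>Growth orders of scalar nets and the sharp norm\<close>

text \<open>Multiplying by a net of order \<open>a\<close> shifts every admissible exponent of
  \<open>s\<close> by \<open>a\<close>, so the valuation goes up by at least \<open>a\<close>. With
  \<open>a = 0\<close> this is monotonicity up to a constant factor.\<close>

lemma sharp_norm_mult_le:
  assumes r: "bigO_pow r a" and s: "moderate s"
    and le: "\<And>\<epsilon>. \<epsilon> \<in> {0<..1} \<Longrightarrow> \<bar>t \<epsilon>\<bar> \<le> \<bar>r \<epsilon> * s \<epsilon>\<bar>"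
  shows "sharp_norm t \<le> exp (- a) * sharp_norm s"
proof -
  have t: "bigO_pow t (a + b)" if "bigO_pow s b" for b
    using bigO_pow_mult[OF r that] le by (rule bigO_pow_le)
  show ?thesis
  proof (cases "sharp_val s")
    case (real v)
    \<comment> \<open>The supremum defining \<open>sharp_val s\<close> need not be attained, so
      exponents \<open>v - e\<close> below it are used.\<close>
    have "ereal (a + v) \<le> sharp_val t"
    proof (rule ereal_le_epsilon2)
      fix e :: real assume "0 < e"
      then have "bigO_pow t (a + (v - e))"
        by (intro t sharp_val_gt) (simp add: real)
      then have "ereal (a + (v - e)) \<le> sharp_val t"
        by (auto simp: sharp_val_def intro: Sup_upper)
      then show "ereal (a + v) \<le> sharp_val t + ereal e"
        by (cases "sharp_val t") auto
    qed
    then show ?thesis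
      by (cases "sharp_val t") (auto simp: sharp_norm_def real simp flip: exp_add)
  next
    case PInf
    \<comment> \<open>Here \<open>s\<close> is negligible, so every exponent is admissible for
      \<open>t\<close> as well and its sharp norm is 0.\<close>
    then have "bigO_pow t b" for b
      using t[of "b - a"] by (auto simp: sharp_val_PInf_iff intro: negligible_bigO_pow)
    then show ?thesis
      by (simp add: negligible_net_def sharp_norm_0_iff[THEN iffD2] sharp_norm_nonneg)
  next
    case MInf
    with s show ?thesis by (simp add: sharp_val_moderate)
  qed
qed

lemma bigO_pow_const_mult_power: "bigO_pow (\<lambda>\<epsilon>. C * \<epsilon> ^ q) (real q)"
proof -
  have "eventually (\<lambda>\<epsilon>::real. \<epsilon> \<in> {0<..<1}) (at_right 0)"
    by (rule eventually_at_right_real) simp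
  then have "eventually (\<lambda>\<epsilon>. norm (C * \<epsilon> ^ q) \<le> \<bar>C\<bar> * norm (\<epsilon> powr real q)) (at_right 0)"
    by eventually_elim (auto simp: abs_mult powr_realpow)
  then show ?thesis unfolding bigO_pow_def by (rule bigoI)
qed

lemma moderate_inverse_power: "moderate (\<lambda>\<epsilon>. (1 / \<epsilon>) ^ q)"
proof -
  have "eventually (\<lambda>\<epsilon>::real. \<epsilon> \<in> {0<..<1}) (at_right 0)"
    by (rule eventually_at_right_real) simp
  then have "eventually (\<lambda>\<epsilon>. norm ((1 / \<epsilon>) ^ q) \<le> 1 * norm (\<epsilon> powr - real q)) (at_right 0)"
    by eventually_elim (auto simp: powr_minus powr_realpow field_simps)
  then show ?thesis unfolding moderate_def bigO_pow_def by (blast intro: bigoI)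
qed

lemma moderate_power: "moderate r \<Longrightarrow> moderate (\<lambda>\<epsilon>. r \<epsilon> ^ k)"
  by (induction k) (simp_all add: moderate_const moderate_mult)

section \<open>Dilations of Schwartz functions\<close>

text \<open>The factor \<open>k\<close> lets the rule be iterated: differentiating a multiple of a
  dilate gives a multiple of a dilate again, which is the shape met in the induction over lists of
  partial derivatives.\<close>

lemma has_derivative_dilate:
  fixes f :: "'a::real_normed_vector \<Rightarrow> 'b::real_normed_vector"
  assumes "(f has_derivative f') (at (c *\<^sub>R (x - y)))"
  shows "((\<lambda>y. k *\<^sub>R f (c *\<^sub>R (x - y))) has_derivative (\<lambda>h. (k * - c) *\<^sub>R f' h)) (at y)"
proof -
  have "((\<lambda>y. c *\<^sub>R (x - y)) has_derivative (\<lambda>h. (- c) *\<^sub>R h)) (at y)"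
    by (auto intro!: derivative_eq_intros)
  from has_derivative_compose[OF this, of f f'] assms
  have "((\<lambda>y. f (c *\<^sub>R (x - y))) has_derivative (\<lambda>h. f' ((- c) *\<^sub>R h))) (at y)"
    by simp
  from has_derivative_scaleR_right[OF this, of k] show ?thesis
    using linear_cmul[OF has_derivative_linear[OF assms], of "- c"] by simp
qed

lemma partial_derivs_dilate:
  assumes "smooth f"
  shows "partial_derivs is (\<lambda>y. f (c *\<^sub>R (x - y))) =
    (\<lambda>y. ((- c) ^ length is) *\<^sub>R partial_derivs is f (c *\<^sub>R (x - y)))"
proof (induction "is")
  case (Cons i "is")
  show ?case
  proof
    fix y
    obtain f' where d: "(partial_derivs is f has_derivative f') (at (c *\<^sub>R (x - y)))"
      using smoothD[OF assms] unfolding differentiable_def by meson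
    show "partial_derivs (i # is) (\<lambda>y. f (c *\<^sub>R (x - y))) y =
        ((- c) ^ length (i # is)) *\<^sub>R partial_derivs (i # is) f (c *\<^sub>R (x - y))"
      using partial_deriv_eq[OF has_derivative_dilate[OF d, of "(- c) ^ length is"], of i]
        partial_deriv_eq[OF d, of i]
      by (simp add: partial_derivs_Cons Cons mult.commute)
  qed
qed (simp add: partial_derivs_Nil)

lemma smooth_dilate:
  assumes "smooth f" shows "smooth (\<lambda>y. f (c *\<^sub>R (x - y)))"
  unfolding smooth_def partial_derivs_dilate[OF assms]
proof (intro allI)
  fix "is" y
  obtain f' where "(partial_derivs is f has_derivative f') (at (c *\<^sub>R (x - y)))"
    using smoothD[OF assms] unfolding differentiable_def by meson
  from has_derivative_dilate[OF this]
  show "(\<lambda>y. ((- c) ^ length is) *\<^sub>R partial_derivs is f (c *\<^sub>R (x - y))) differentiable (at y)"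
    by (rule differentiableI)
qed

lemma multi_deriv_dilate:
  assumes "smooth f"
  shows "multi_deriv \<alpha> (\<lambda>y. f (c *\<^sub>R (x - y))) y =
    ((- c) ^ (\<Sum>i\<in>UNIV. \<alpha> i)) *\<^sub>R multi_deriv \<alpha> f (c *\<^sub>R (x - y))"
proof -
  \<comment> \<open>\<open>coords\<close> lists each index exactly once, so the number of
    differentiations is the order of the multi-index.\<close>
  have "length (concat (map (\<lambda>i. replicate (\<alpha> i) i) coords)) = (\<Sum>i\<in>UNIV. \<alpha> i)"
    by (simp add: length_concat o_def sum_list_distinct_conv_sum_set distinct_coords set_coords)
  then show ?thesis by (simp add: multi_deriv_def partial_derivs_dilate[OF assms])
qed

text \<open>With z = c(x - y) and c \<ge> 1 one has |y| \<le> |x| + |z|, hence 1 + |y| \<le> (1 +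
  |x|)(1 + |z|), while the chain rule factor is at most \<open>c ^ j\<close>. The bound is
  polynomial in c and |x|, so it stays moderate along moderate nets.\<close>

lemma
  assumes f: "schwartz f" and c: "1 \<le> c"
  shows schwartz_dilate: "schwartz (\<lambda>y. f (c *\<^sub>R (x - y)))"
    and schwartz_norm_dilate:
      "schwartz_norm j (\<lambda>y. f (c *\<^sub>R (x - y))) \<le> (c * (1 + norm x)) ^ j * schwartz_norm j f"
proof -
  have sm: "smooth f" using f by (simp add: schwartz_def)
  \<comment> \<open>The index \<open>j\<close> is generalized here: a single instance gives the norm
    bound, all of them together give membership in the Schwartz space.\<close>
  have *: "(1 + norm y) ^ j * norm (multi_deriv \<alpha> (\<lambda>y. f (c *\<^sub>R (x - y))) y)
      \<le> (c * (1 + norm x)) ^ j * schwartz_norm j f"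
    if \<alpha>: "(\<Sum>i\<in>UNIV. \<alpha> i) \<le> j" for y \<alpha> j
  proof -
    let ?z = "c *\<^sub>R (x - y)"
    have "norm y \<le> norm x + norm (x - y)"
      by (metis norm_minus_commute norm_triangle_sub)
    also have "norm (x - y) \<le> norm ?z" using c by (simp add: mult_right_mono[of 1 c, simplified])
    finally have "1 + norm y \<le> (1 + norm x) * (1 + norm ?z)"
      using mult_nonneg_nonneg[OF norm_ge_zero[of x] norm_ge_zero[of ?z]]
      unfolding distrib_left distrib_right by linarith
    then have 1: "(1 + norm y) ^ j \<le> (1 + norm x) ^ j * (1 + norm ?z) ^ j"
      by (metis power_mult_distrib power_mono norm_ge_zero add_nonneg_nonneg zero_le_one)
    have 2: "\<bar>(- c) ^ (\<Sum>i\<in>UNIV. \<alpha> i)\<bar> \<le> c ^ j"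
      using power_increasing[OF \<alpha> c] c by (simp add: power_abs)
    have "(1 + norm y) ^ j * norm (multi_deriv \<alpha> (\<lambda>y. f (c *\<^sub>R (x - y))) y)
        \<le> ((1 + norm x) ^ j * (1 + norm ?z) ^ j) * (c ^ j * norm (multi_deriv \<alpha> f ?z))"
      unfolding multi_deriv_dilate[OF sm] norm_scaleR[of "(- c) ^ _"]
      by (rule mult_mono[OF 1 mult_right_mono[OF 2]]) auto
    also have "\<dots> = (c * (1 + norm x)) ^ j * ((1 + norm ?z) ^ j * norm (multi_deriv \<alpha> f ?z))"
      by (simp add: power_mult_distrib mult_ac)
    also have "\<dots> \<le> (c * (1 + norm x)) ^ j * schwartz_norm j f"
      using c by (intro mult_left_mono schwartz_norm_upper[OF f \<alpha>]) auto
    finally show ?thesis .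
  qed
  show "schwartz_norm j (\<lambda>y. f (c *\<^sub>R (x - y))) \<le> (c * (1 + norm x)) ^ j * schwartz_norm j f"
    by (rule schwartz_norm_least(1)) (rule *)
  show "schwartz (\<lambda>y. f (c *\<^sub>R (x - y)))"
    using sm schwartz_norm_least(2)[OF *] by (auto simp: schwartz_def smooth_dilate)
qed

text \<open>For \<epsilon> in (0,1] the dilation factor \<open>(1 / \<epsilon>) ^ q\<close> is at
  least 1, so \<open>schwartz_norm_dilate\<close> bounds each seminorm by powers of 1/\<epsilon> and
  1 + |\<open>x \<epsilon>\<close>|.\<close>

lemma regularization_in_ES:
  fixes x :: "real \<Rightarrow> real^'n"
  assumes x: "x \<in> moderate_nets" and \<rho>: "schwartz \<rho>"
  shows "regularization x \<rho> q \<in> ES"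
proof -
  let ?c = "\<lambda>\<epsilon>::real. (1 / \<epsilon>) ^ q"
  have reg: "regularization x \<rho> q \<epsilon> =
      (\<lambda>y. complex_of_real (?c \<epsilon> ^ CARD('n)) * \<rho> (?c \<epsilon> *\<^sub>R (x \<epsilon> - y)))" for \<epsilon>
    by (auto simp: regularization_def rescale_def scaleR_conv_of_real power_one_over)
  have c: "1 \<le> ?c \<epsilon>" if "\<epsilon> \<in> {0<..1}" for \<epsilon>
    using that by (intro one_le_power) auto
  show ?thesis
  proof (rule ES_I[where r = "\<lambda>j \<epsilon>. ?c \<epsilon> ^ CARD('n) *
        ((?c \<epsilon> * (1 + norm (x \<epsilon>))) ^ j * schwartz_norm j \<rho>)"])
    fix \<epsilon> :: real and j assume e: "\<epsilon> \<in> {0<..1}"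
    note s = schwartz_dilate[OF \<rho> c[OF e], of "x \<epsilon>"]
    show "schwartz (regularization x \<rho> q \<epsilon>)"
      unfolding reg by (rule schwartz_cmult[OF s])
    have "schwartz_norm j (regularization x \<rho> q \<epsilon>)
        \<le> ?c \<epsilon> ^ CARD('n) * schwartz_norm j (\<lambda>y. \<rho> (?c \<epsilon> *\<^sub>R (x \<epsilon> - y)))"
      using schwartz_norm_cmult[OF s, of j "complex_of_real (?c \<epsilon> ^ CARD('n))"] e
      unfolding reg norm_of_real by simp
    also have "\<dots> \<le> ?c \<epsilon> ^ CARD('n) * ((?c \<epsilon> * (1 + norm (x \<epsilon>))) ^ j * schwartz_norm j \<rho>)"
      using e by (intro mult_left_mono schwartz_norm_dilate[OF \<rho> c[OF e]]) auto
    finally show "schwartz_norm j (regularization x \<rho> q \<epsilon>)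
        \<le> ?c \<epsilon> ^ CARD('n) * ((?c \<epsilon> * (1 + norm (x \<epsilon>))) ^ j * schwartz_norm j \<rho>)" .
  next
    fix j
    have "moderate (\<lambda>\<epsilon>. 1 + norm (x \<epsilon>))"
      using x by (intro moderate_add moderate_const) (simp add: moderate_nets_def)
    then show "moderate (\<lambda>\<epsilon>. ?c \<epsilon> ^ CARD('n) *
        ((?c \<epsilon> * (1 + norm (x \<epsilon>))) ^ j * schwartz_norm j \<rho>))"
      by (intro moderate_mult moderate_power moderate_const moderate_inverse_power)
  qed
qed

section \<open>The regularization error\<close>

text \<open>Change of variables y = x - \<eta> z, with Jacobian \<eta>^n in absolute value. The
  reflection is built in so that x - y becomes \<eta> z in the convolution with \<rho>.\<close>

lemma lborel_integral_reflect_dilate: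
  fixes g :: "real^'n::finite \<Rightarrow> complex"
  assumes [measurable]: "g \<in> borel_measurable borel" and "0 < \<eta>"
  shows "(\<integral>y. g y \<partial>lborel) = (\<integral>z. (\<eta> ^ CARD('n)) *\<^sub>R g (x - \<eta> *\<^sub>R z) \<partial>lborel)"
proof -
  have "(\<integral>y. g y \<partial>lborel) =
      (\<integral>y. g y \<partial>density (distr lborel borel (\<lambda>z. x + (- \<eta>) *\<^sub>R z)) (\<lambda>_. \<bar>- \<eta>\<bar> ^ DIM(real^'n)))"
    using assms(2) by (subst lborel_affine[of "- \<eta>" x]) (auto simp: DIM_cart)
  also have "\<dots> = (\<integral>z. (\<eta> ^ CARD('n)) *\<^sub>R g (x - \<eta> *\<^sub>R z) \<partial>lborel)"
    using assms(2) by (subst integral_density) (auto simp: integral_distr)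
  finally show ?thesis .
qed

text \<open>The index n + 3 splits as 1 + (n + 2): one power of the weight absorbs the factor |z| of
  the Lipschitz estimate, the others leave the integrable weight \<open>?w\<close>.\<close>

lemma rescale_integral_error:
  fixes \<rho> f :: "real^'n::finite \<Rightarrow> complex"
  assumes \<rho>: "schwartz \<rho>" "(\<integral>y. \<rho> y \<partial>lborel) = 1" and f: "schwartz f" and \<eta>: "0 < \<eta>"
  shows "norm ((\<integral>y. rescale \<eta> \<rho> (x - y) * f y \<partial>lborel) - f x)
    \<le> (\<integral>y. 1 / (1 + norm (y::real^'n)) ^ (CARD('n) + 2) \<partial>lborel) *
        (schwartz_norm (CARD('n) + 3) \<rho> * (real CARD('n) * schwartz_norm 1 f * \<eta>))"
proof -
  let ?w = "\<lambda>z::real^'n. 1 / (1 + norm z) ^ (CARD('n) + 2)"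
  let ?P = "schwartz_norm (CARD('n) + 3) \<rho>" and ?L = "real CARD('n) * schwartz_norm 1 f"
  let ?e = "\<lambda>z. \<rho> z * (f (x - \<eta> *\<^sub>R z) - f x)"
  note [measurable] = schwartz_measurable[OF \<rho>(1)] schwartz_measurable[OF f]
  have bnd: "norm (?e z) \<le> ?w z * (?P * (?L * \<eta>))" for z
  proof -
    have "norm z * norm (\<rho> z) * (1 + norm z) ^ (CARD('n) + 2)
        \<le> (1 + norm z) * norm (\<rho> z) * (1 + norm z) ^ (CARD('n) + 2)"
      by (intro mult_right_mono) auto
    also have "\<dots> = (1 + norm z) ^ (CARD('n) + 3) * norm (\<rho> z)"
      by (simp add: eval_nat_numeral)
    also have "\<dots> \<le> ?P" by (rule schwartz_norm_weight[OF \<rho>(1)])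
    finally have 1: "norm z * norm (\<rho> z) \<le> ?w z * ?P"
      using zero_less_power[of "1 + norm z" "CARD('n) + 2"]
      by (simp add: pos_le_divide_eq add_pos_nonneg del: power_Suc power_add_numeral2 add_2_eq_Suc add_2_eq_Suc')
    have "norm (f (x - \<eta> *\<^sub>R z) - f x) \<le> ?L * (\<eta> * norm z)"
      using schwartz_lipschitz[OF f, of "x - \<eta> *\<^sub>R z" x] \<eta> by simp
    then have "norm (?e z) \<le> norm (\<rho> z) * (?L * (\<eta> * norm z))"
      unfolding norm_mult by (intro mult_left_mono) auto
    also have "\<dots> = (norm z * norm (\<rho> z)) * (?L * \<eta>)" by (simp add: mult_ac)
    also have "\<dots> \<le> (?w z * ?P) * (?L * \<eta>)"
      using \<eta> schwartz_norm_nonneg[OF f] by (intro mult_right_mono 1) auto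
    finally show ?thesis by (simp only: mult.assoc)
  qed
  have iw: "integrable lborel (\<lambda>z. ?w z * (?P * (?L * \<eta>)))"
    by (intro integrable_mult_left integrable_weight)
  have ie: "integrable lborel ?e"
    by (rule Bochner_Integration.integrable_bound[OF iw])
      (use order_trans[OF bnd abs_ge_self] in \<open>simp_all del: power_Suc power_add_numeral2 add_2_eq_Suc add_2_eq_Suc'\<close>)
  \<comment> \<open>A non-integrable function has Bochner integral 0 by convention, so the value 1
    forces integrability.\<close>
  have i\<rho>: "integrable lborel \<rho>"
    using \<rho>(2) not_integrable_integral_eq by fastforce
  have "(\<integral>y. rescale \<eta> \<rho> (x - y) * f y \<partial>lborel) =
      (\<integral>z. (\<eta> ^ CARD('n)) *\<^sub>R (rescale \<eta> \<rho> (x - (x - \<eta> *\<^sub>R z)) * f (x - \<eta> *\<^sub>R z)) \<partial>lborel)"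
    using \<eta> by (intro lborel_integral_reflect_dilate) (simp_all add: rescale_def)
  \<comment> \<open>The Jacobian cancels the normalization in \<open>rescale\<close>; splitting off
    \<open>\<rho> z * f x\<close> isolates the error term.\<close>
  also have "\<dots> = (\<integral>z. ?e z + \<rho> z * f x \<partial>lborel)"
    using \<eta> by (simp add: rescale_def algebra_simps)
  also have "\<dots> = (\<integral>z. ?e z \<partial>lborel) + (\<integral>z. \<rho> z * f x \<partial>lborel)"
    by (intro Bochner_Integration.integral_add ie integrable_mult_left i\<rho>)
  also have "(\<integral>z. \<rho> z * f x \<partial>lborel) = f x" by (simp add: \<rho>(2))
  finally have "(\<integral>y. rescale \<eta> \<rho> (x - y) * f y \<partial>lborel) - f x = (\<integral>z. ?e z \<partial>lborel)" by simp
  also have "norm \<dots> \<le> (\<integral>z. ?w z * (?P * (?L * \<eta>)) \<partial>lborel)"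
    by (rule Bochner_Integration.integral_norm_bound_integral[OF ie iw]) (rule bnd)
  also have "\<dots> = (\<integral>z. ?w z \<partial>lborel) * (?P * (?L * \<eta>))"
    by (rule integral_mult_left_zero)
  finally show ?thesis .
qed

section \<open>Continuous functionals\<close>

lemma gen_of_diff:
  assumes "x \<in> moderate_nets" "y \<in> moderate_nets"
  shows "gen_of x - gen_of y = gen_of (\<lambda>\<epsilon>. x \<epsilon> - y \<epsilon>)"
proof -
  have "gen_rel (\<lambda>\<epsilon>. - y \<epsilon>) (\<lambda>\<epsilon>. - y \<epsilon>)"
    using assms(2) by (simp add: gen_rel_refl moderate_nets_def)
  with assms show ?thesis
    by (simp add: minus_gen_def uminus_gen.abs_eq plus_gen.abs_eq gen_rel_refl)
qed

lemma e_norm_gen_of: "x \<in> moderate_nets \<Longrightarrow> e_norm (gen_of x) = sharp_norm (\<lambda>\<epsilon>. norm (x \<epsilon>))"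
  by (simp add: e_norm.abs_eq gen_rel_refl)

lemma GS_norm_GS_of: "u \<in> ES \<Longrightarrow> GS_norm j (GS_of u) = sharp_norm (\<lambda>\<epsilon>. schwartz_norm j (u \<epsilon>))"
  by (simp add: GS_norm.abs_eq GS_rel_refl)

lemma GS_norm_nonneg: "0 \<le> GS_norm j u"
  by transfer (rule sharp_norm_nonneg)

text \<open>Representatives are Schwartz only for \<epsilon> in (0,1], so the seminorm nets of w and
  -w are compared there, through \<open>sharp_norm_mult_le\<close> with the constant factor 1 of
  order 0. The inequality, used for both differences, gives equality.\<close>

lemma GS_norm_minus_commute: "GS_norm j (u - v) = GS_norm j (v - u)"
proof -
  have "GS_norm j (- w) \<le> GS_norm j w" for w :: "'a GS"
  proof (transfer fixing: j)
    fix u :: "real \<Rightarrow> real^'a \<Rightarrow> complex" assume "GS_rel u u"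
    then have u: "u \<in> ES" by (simp add: GS_rel_refl)
    have "sharp_norm (\<lambda>\<epsilon>. schwartz_norm j (\<lambda>y. - u \<epsilon> y))
        \<le> exp (- 0) * sharp_norm (\<lambda>\<epsilon>. schwartz_norm j (u \<epsilon>))"
      using bigO_pow_const_mult_power[of 1 0] ES_D[OF u]
      by (intro sharp_norm_mult_le) (auto simp: schwartz_norm_uminus)
    then show "sharp_norm (\<lambda>\<epsilon>. schwartz_norm j (\<lambda>y. - u \<epsilon> y))
        \<le> sharp_norm (\<lambda>\<epsilon>. schwartz_norm j (u \<epsilon>))" by simp
  qed
  from this[of "u - v"] this[of "v - u"] show ?thesis by simp
qed

lemma module_gen_mult: "module ((*) :: 'a::comm_ring_1 \<Rightarrow> 'a \<Rightarrow> 'a)"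
  by unfold_locales (simp_all add: algebra_simps)

text \<open>By additivity the bound by one seminorm is a Lipschitz estimate at every point, hence
  continuity.\<close>

lemma GS_dualI:
  assumes add: "\<And>u v. T (u + v) = T u + T v"
    and scale: "\<And>z u. T (GS_scale z u) = z * T u"
    and bnd: "\<And>u. e_norm (T u) \<le> C * GS_norm j u"
  shows "T \<in> GS_dual"
proof -
  have diff: "T (u - v) = T u - T v" for u v
    using add[of "u - v" v] by simp
  have "continuous_map GS_topology euclidean T"
    unfolding continuous_map_openin_preimage_eq
  proof (intro conjI allI impI)
    fix U :: "complex gen set" assume "openin euclidean U"
    then have U: "open U" by simp
    have "\<exists>F r. finite F \<and> F \<subseteq> UNIV \<and> 0 < r \<and>
        (\<forall>v\<in>UNIV. (\<forall>j\<in>F. ennreal (GS_norm j (u - v)) < r) \<longrightarrow> v \<in> T -` U)" if u: "T u \<in> U" for u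
    proof -
      obtain e where e: "0 < e" "\<And>z. dist z (T u) < e \<Longrightarrow> z \<in> U"
        using U u unfolding open_dist by blast
      show ?thesis
      \<comment> \<open>The denominator \<open>\<bar>C\<bar> + 1\<close> is positive for every real
        \<open>C\<close>.\<close>
      proof (intro exI[of _ "{j}"] exI[of _ "ennreal (e / (\<bar>C\<bar> + 1))"] conjI ballI impI)
        show "0 < ennreal (e / (\<bar>C\<bar> + 1))" using e(1) by (simp add: add_nonneg_pos)
        fix v assume "\<forall>i\<in>{j}. ennreal (GS_norm i (u - v)) < ennreal (e / (\<bar>C\<bar> + 1))"
        then have "GS_norm j (u - v) < e / (\<bar>C\<bar> + 1)"
          by (simp add: ennreal_less_iff GS_norm_nonneg)
        then have lt: "(\<bar>C\<bar> + 1) * GS_norm j (v - u) < e"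
          by (simp add: pos_less_divide_eq add_nonneg_pos mult.commute GS_norm_minus_commute)
        have "dist (T v) (T u) \<le> C * GS_norm j (v - u)"
          using bnd[of "v - u"] by (simp add: dist_gen_def diff)
        also have "\<dots> \<le> (\<bar>C\<bar> + 1) * GS_norm j (v - u)"
          by (intro mult_right_mono GS_norm_nonneg) simp
        finally show "v \<in> T -` U" using e(2) lt by simp
      qed auto
    qed
    then show "openin GS_topology (topspace GS_topology \<inter> T -` U)"
      unfolding GS_topology_def openin_topology_of_pseudometrics
        topspace_topology_of_pseudometrics by simp
  qed auto
  moreover have "module_hom GS_scale (*) T"
    by (intro module_hom.intro module_hom_axioms.intro GS.module_axioms module_gen_mult add scale)
  ultimately show ?thesis by (simp add: GS_dual_def)
qed

lemma GS_delta_moderate: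
  assumes "u \<in> ES" shows "(\<lambda>\<epsilon>. u \<epsilon> (x \<epsilon>)) \<in> moderate_nets"
  unfolding moderate_nets_def mem_Collect_eq
  by (rule moderate_le[OF ES_D(2)[OF assms, of 0]])
    (use ES_D(1)[OF assms] in \<open>auto simp: schwartz_norm_nonneg schwartz_norm_0_upper\<close>)

text \<open>Point values are dominated by the sup norm p_0. The constant 1 is written
  \<open>exp (- 0)\<close> to match \<open>sharp_norm_mult_le\<close>.\<close>

lemma GS_delta_in_dual: "GS_delta a \<in> GS_dual"
proof (rule GS_dualI)
  fix u v z
  show "GS_delta a (u + v) = GS_delta a u + GS_delta a v"
    by transfer (auto simp: gen_rel_refl GS_rel_refl GS_delta_moderate intro: moderate_nets_add)
  show "GS_delta a (GS_scale z u) = z * GS_delta a u"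
    by transfer (auto simp: gen_rel_refl GS_rel_refl GS_delta_moderate intro: moderate_nets_mult)
  show "e_norm (GS_delta a u) \<le> exp (- 0) * GS_norm 0 u"
  proof transfer
    fix a :: "real \<Rightarrow> real^'a" and u :: "real \<Rightarrow> real^'a \<Rightarrow> complex" assume "GS_rel u u"
    then have u: "u \<in> ES" by (simp add: GS_rel_refl)
    show "sharp_norm (\<lambda>\<epsilon>. norm (u \<epsilon> (a \<epsilon>))) \<le> exp (- 0) * sharp_norm (\<lambda>\<epsilon>. schwartz_norm 0 (u \<epsilon>))"
      using bigO_pow_const_mult_power[of 1 0] ES_D[OF u]
      by (intro sharp_norm_mult_le) (auto simp: schwartz_norm_nonneg schwartz_norm_0_upper)
  qed
qed

text \<open>The respectfulness theorem of \<open>GS_functional\<close>, taken on the diagonal, says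
  exactly that the result net is moderate.\<close>

lemma GS_functional_moderate:
  assumes "v \<in> ES" "u \<in> ES" shows "(\<lambda>\<epsilon>. \<integral>y. v \<epsilon> y * u \<epsilon> y \<partial>lborel) \<in> moderate_nets"
  using rel_funD[OF rel_funD[OF GS_functional.rsp], of v v u u] assms
  by (simp add: gen_rel_refl GS_rel_refl)

text \<open>For \<open>\<epsilon>\<close> outside \<open>(0,1]\<close> the representatives need not be integrable, so pointwise identities
  between integrals are only available up to \<^const>\<open>gen_rel\<close>.\<close>

lemma gen_relI:
  assumes "x \<in> moderate_nets" "y \<in> moderate_nets" "\<And>\<epsilon>. \<epsilon> \<in> {0<..1} \<Longrightarrow> x \<epsilon> = y \<epsilon>"
  shows "gen_rel x y"
  unfolding gen_rel_def
  using assms by (auto intro: negligible_net_le[OF negligible_net_0])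

text \<open>A representative \<open>w\<close> of \<open>v\<close> satisfies |\<integral>wu| \<le> K
  p_0(w) p_{n+2}(u). The first two factors grow at most like a power -N of \<epsilon>, which yields
  the continuity constant e^N.\<close>

lemma GS_functional_in_dual: "GS_functional v \<in> GS_dual"
proof -
  obtain w where w: "w \<in> ES" "v = GS_of w"
    by (rule GS.abs_induct[of "\<lambda>v. \<exists>w\<in>ES. v = GS_of w", THEN bexE]) (auto simp: GS_rel_refl)
  let ?K = "\<integral>y. 1 / (1 + norm (y::real^'a)) ^ (CARD('a) + 2) \<partial>lborel"
  have "moderate (\<lambda>\<epsilon>. ?K * schwartz_norm 0 (w \<epsilon>))"
    by (intro moderate_mult moderate_const ES_D(2) w)
  then obtain N :: nat where N: "bigO_pow (\<lambda>\<epsilon>. ?K * schwartz_norm 0 (w \<epsilon>)) (- real N)"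
    by (auto simp: moderate_def)
  show ?thesis
  proof (rule GS_dualI)
    fix u u' z
    show "GS_functional v (u + u') = GS_functional v u + GS_functional v u'"
    proof transfer
      fix v u u' :: "real \<Rightarrow> real^'a \<Rightarrow> complex"
      assume "GS_rel v v" "GS_rel u u" "GS_rel u' u'"
      then have E: "v \<in> ES" "u \<in> ES" "u' \<in> ES" by (simp_all add: GS_rel_refl)
      show "gen_rel (\<lambda>\<epsilon>. \<integral>y. v \<epsilon> y * (u \<epsilon> y + u' \<epsilon> y) \<partial>lborel)
          (\<lambda>\<epsilon>. (\<integral>y. v \<epsilon> y * u \<epsilon> y \<partial>lborel) + (\<integral>y. v \<epsilon> y * u' \<epsilon> y \<partial>lborel))"
        by (intro gen_relI moderate_nets_add GS_functional_moderate ES_add E)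
          (simp add: distrib_left E ES_D(1) schwartz_integrable_mult)
    qed
    show "GS_functional v (GS_scale z u) = z * GS_functional v u"
    proof transfer
      fix z :: "real \<Rightarrow> complex" and v u :: "real \<Rightarrow> real^'a \<Rightarrow> complex"
      assume "gen_rel z z" "GS_rel v v" "GS_rel u u"
      then have E: "z \<in> moderate_nets" "v \<in> ES" "u \<in> ES"
        by (simp_all add: GS_rel_refl gen_rel_refl)
      show "gen_rel (\<lambda>\<epsilon>. \<integral>y. v \<epsilon> y * (z \<epsilon> * u \<epsilon> y) \<partial>lborel)
          (\<lambda>\<epsilon>. z \<epsilon> * (\<integral>y. v \<epsilon> y * u \<epsilon> y \<partial>lborel))"
        by (intro gen_relI moderate_nets_mult GS_functional_moderate ES_scale E)
          (simp add: mult.left_commute)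
    qed
    show "e_norm (GS_functional v u) \<le> exp (- (- real N)) * GS_norm (CARD('a) + 2) u"
      unfolding w(2)
    proof (induction u rule: GS.abs_induct)
      case (1 u)
      then have u: "u \<in> ES" by (simp add: GS_rel_refl)
      have "sharp_norm (\<lambda>\<epsilon>. norm (\<integral>y. w \<epsilon> y * u \<epsilon> y \<partial>lborel))
          \<le> exp (- (- real N)) * sharp_norm (\<lambda>\<epsilon>. schwartz_norm (CARD('a) + 2) (u \<epsilon>))"
      proof (rule sharp_norm_mult_le[OF N ES_D(2)[OF u]])
        fix \<epsilon> :: real assume e: "\<epsilon> \<in> {0<..1}"
        show "\<bar>norm (\<integral>y. w \<epsilon> y * u \<epsilon> y \<partial>lborel)\<bar>
            \<le> \<bar>?K * schwartz_norm 0 (w \<epsilon>) * schwartz_norm (CARD('a) + 2) (u \<epsilon>)\<bar>"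
          unfolding abs_norm_cancel mult.assoc
          by (rule order_trans[OF schwartz_integral_bound[OF ES_D(1)[OF w(1) e] ES_D(1)[OF u e]] abs_ge_self])
      qed
      then show ?case
        using w u by (simp only: GS_functional.abs_eq GS_rel_refl e_norm_gen_of
            GS_functional_moderate GS_norm_GS_of)
    qed
  qed
qed

section \<open>Uniform convergence on bounded sets\<close>

text \<open>This is \<open>rescale_integral_error\<close> on representatives with \<eta> =
  \<open>\<epsilon> ^ q\<close>. Since \<open>?C\<close> is independent of \<epsilon>, it disappears
  in the sharp norm and the bound is free of \<rho> and \<open>x\<close>.\<close>

lemma e_norm_regularization_error:
  fixes x :: "real \<Rightarrow> real^'n"
  assumes x: "x \<in> moderate_nets" and \<rho>: "schwartz \<rho>" "(\<integral>y. \<rho> y \<partial>lborel) = 1"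
  shows "e_norm (GS_functional (GS_of (regularization x \<rho> q)) u - GS_delta (gen_of x) u)
    \<le> exp (- real q) * GS_norm 1 u"
proof (induction u rule: GS.abs_induct)
  case (1 u)
  then have u: "u \<in> ES" by (simp add: GS_rel_refl)
  note reg = regularization_in_ES[OF x \<rho>(1), of q]
  let ?T = "\<lambda>\<epsilon>. \<integral>y. regularization x \<rho> q \<epsilon> y * u \<epsilon> y \<partial>lborel" and ?D = "\<lambda>\<epsilon>. u \<epsilon> (x \<epsilon>)"
  let ?K = "\<integral>y. 1 / (1 + norm (y::real^'n)) ^ (CARD('n) + 2) \<partial>lborel"
  let ?C = "?K * (schwartz_norm (CARD('n) + 3) \<rho> * real CARD('n))"
  have "sharp_norm (\<lambda>\<epsilon>. norm (?T \<epsilon> - ?D \<epsilon>))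
      \<le> exp (- real q) * sharp_norm (\<lambda>\<epsilon>. schwartz_norm 1 (u \<epsilon>))"
  proof (rule sharp_norm_mult_le[OF bigO_pow_const_mult_power[of ?C] ES_D(2)[OF u]])
    fix \<epsilon> :: real assume e: "\<epsilon> \<in> {0<..1}"
    then have "norm (?T \<epsilon> - ?D \<epsilon>) \<le>
        ?K * (schwartz_norm (CARD('n) + 3) \<rho> * (real CARD('n) * schwartz_norm 1 (u \<epsilon>) * \<epsilon> ^ q))"
      unfolding regularization_def
      by (intro rescale_integral_error \<rho> ES_D(1)[OF u]) auto
    also have "\<dots> = ?C * \<epsilon> ^ q * schwartz_norm 1 (u \<epsilon>)" by (simp only: mult_ac)
    finally show "\<bar>norm (?T \<epsilon> - ?D \<epsilon>)\<bar> \<le> \<bar>?C * \<epsilon> ^ q * schwartz_norm 1 (u \<epsilon>)\<bar>"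
      unfolding abs_norm_cancel by (rule order_trans[OF _ abs_ge_self])
  qed
  moreover have "GS_functional (GS_of (regularization x \<rho> q)) (GS_of u) = gen_of ?T"
    using reg u by (simp add: GS_functional.abs_eq GS_rel_refl)
  moreover have "GS_delta (gen_of x) (GS_of u) = gen_of ?D"
    using x u by (simp add: GS_delta.abs_eq GS_rel_refl gen_rel_refl)
  ultimately show ?case
    using reg u by (simp add: gen_of_diff e_norm_gen_of GS_functional_moderate GS_delta_moderate
        moderate_nets_diff GS_norm_GS_of)
qed

text \<open>A basic neighbourhood of \<open>l\<close> constrains finitely many pseudometrics, and a
  finite conjunction of eventual properties holds eventually.\<close>

lemma limitin_topology_of_pseudometrics:
  assumes "l \<in> S" "\<And>n. f n \<in> S" "\<And>i. i \<in> I \<Longrightarrow> ((\<lambda>n. d i l (f n)) \<longlongrightarrow> 0) F"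
  shows "limitin (topology_of_pseudometrics S I d) f l F"
  unfolding limitin_def topspace_topology_of_pseudometrics openin_topology_of_pseudometrics
proof (intro conjI allI impI assms(1))
  fix U
  assume "(U \<subseteq> S \<and> (\<forall>x\<in>U. \<exists>F r. finite F \<and> F \<subseteq> I \<and> 0 < r \<and>
    (\<forall>y\<in>S. (\<forall>i\<in>F. d i x y < r) \<longrightarrow> y \<in> U))) \<and> l \<in> U"
  then obtain J r where J: "finite J" "J \<subseteq> I" "0 < r"
      "\<And>y. y \<in> S \<Longrightarrow> \<forall>i\<in>J. d i l y < r \<Longrightarrow> y \<in> U"
    by meson
  have "\<forall>\<^sub>F n in F. \<forall>i\<in>J. d i l (f n) < r"
    unfolding eventually_ball_finite_distrib[OF J(1)]
    by (intro ballI order_tendstoD(2)[OF assms(3) J(3)] subsetD[OF J(2)])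
  then show "\<forall>\<^sub>F n in F. f n \<in> U"
    by eventually_elim (rule J(4)[OF assms(2)])
qed

theorem proposition3p12:
  fixes x :: "real \<Rightarrow> real^'n" and \<rho> :: "real^'n \<Rightarrow> complex"
  assumes "x \<in> moderate_nets"
    and "schwartz \<rho>"
    and "(\<integral>y. \<rho> y \<partial>lborel) = 1"
  shows "(\<forall>q. regularization x \<rho> q \<in> ES \<and> GS_functional (GS_of (regularization x \<rho> q)) \<in> GS_dual) \<and>
    GS_delta (gen_of x) \<in> GS_dual \<and>
    limitin GS_dual_topology (\<lambda>q. GS_functional (GS_of (regularization x \<rho> q)))
      (GS_delta (gen_of x)) sequentially"
proof (intro conjI allI)
  let ?T = "\<lambda>q. GS_functional (GS_of (regularization x \<rho> q))" and ?D = "GS_delta (gen_of x)"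
  show "limitin GS_dual_topology ?T ?D sequentially"
    unfolding GS_dual_topology_def
  proof (rule limitin_topology_of_pseudometrics)
    fix B :: "'n GS set" assume "B \<in> Collect GS_bounded"
    \<comment> \<open>\<open>M\<close> depends on \<open>B\<close> but not on \<open>q\<close>,
      which makes the estimate below uniform on \<open>B\<close>.\<close>
    then obtain M where M: "\<And>u. u \<in> B \<Longrightarrow> GS_norm 1 u \<le> M"
      unfolding GS_bounded_def bdd_above_def by blast
    have le: "(SUP u\<in>B. ennreal (e_norm (?D u - ?T q u))) \<le> ennreal (exp (- real q) * M)" for q
    proof (intro SUP_least ennreal_leI)
      fix u assume "u \<in> B"
      \<comment> \<open>The pseudometrics take the limit as first argument, so the difference is
        reversed.\<close>
      have "e_norm (?D u - ?T q u) = e_norm (?T q u - ?D u)"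
        by (metis e_norm_minus minus_diff_eq)
      also have "\<dots> \<le> exp (- real q) * GS_norm 1 u"
        by (rule e_norm_regularization_error[OF assms])
      also have "\<dots> \<le> exp (- real q) * M"
        using M[OF \<open>u \<in> B\<close>] by simp
      finally show "e_norm (?D u - ?T q u) \<le> exp (- real q) * M" .
    qed
    have "((\<lambda>q. exp (- real q) * M) \<longlongrightarrow> 0 * M) sequentially"
      by (intro tendsto_mult tendsto_const filterlim_compose[OF exp_at_bot]
          filterlim_compose[OF filterlim_uminus_at_bot_at_top] filterlim_real_sequentially)
    from tendsto_ennrealI[OF this]
    have lim: "((\<lambda>q. ennreal (exp (- real q) * M)) \<longlongrightarrow> 0) sequentially" by simp
    show "((\<lambda>q. SUP u\<in>B. ennreal (e_norm (?D u - ?T q u))) \<longlongrightarrow> 0) sequentially"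
      by (rule tendsto_sandwich[OF _ _ tendsto_const lim]) (simp_all add: le)
  qed (rule GS_delta_in_dual GS_functional_in_dual)+
qed (rule regularization_in_ES[OF assms(1,2)] GS_functional_in_dual GS_delta_in_dual)+

end
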